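(* Let $D\subseteq\mathbb{R}$ be an open interval, let $f:D\to\mathbb{R}$ be a sufficiently differentiable function, and let $\alpha\in D$ be a simple root of $f(x)=0$. Let $\kappa\ne0$, $g_1,g_2,h$ and $a_1,\dots,a_8$ be real numbers, and consider the iterative scheme $$w_n=x_n-\kappa f(x_n),\qquad y_n=x_n-\frac{f(x_n)}{f[x_n,w_n]},$$ $$z_n=y_n-\left[\frac{1-g_1-g_2}{f[y_n,w_n]}G_0(t_1)+\frac{g_1}{f[x_n,y_n]}G_1(t_2)+\frac{g_2}{f[x_n,w_n]}G_2(t_1,t_2)\right]f(y_n),$$ $$x_{n+1}=z_n-H(t_3,t_4,t_5)\,\frac{f(z_n)}{f[z_n,y_n]-(h-1)f[z_n,w_n]+h f[z_n,x_n]-h f[y_n,x_n]+(h-1)f[y_n,w_n]},$$ where $t_1=\frac{f(y_n)}{f(x_n)}$, $t_2=\frac{f(y_n)}{f(w_n)}$, $t_3=\frac{f(z_n)}{f(x_n)}$, $t_4=\frac{f(z_n)}{f(w_n)}$, $t_5=\frac{f(z_n)}{f(y_n)}$, and the weight functions have the expansions $$\begin{aligned}G_0(t_1)&=1+t_1+a_1t_1^2+\text{higher powers in }t_1,\\ G_1(t_2)&=1+t_2+a_2t_2^2+\text{higher powers in }t_2,\\ G_2(t_1,t_2)&=1+t_1+t_2+a_3t_1^2+a_4t_2^2+a_5t_1t_2+\text{higher powers in }t_1,t_2,\\ H(t_3,t_4,t_5)&=1+a_6t_3+a_7t_4+a_8t_5+\text{higher powers in }t_3,t_4,t_5.\end{aligned}$$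 If $x_0$ is chosen sufficiently close to $\alpha$, then the following hold. (i) The scheme has convergence order at least six if $$G_0(0)=1,\ G_1(0)=1,\ G_2(0,0)=1,\ H(0,0,0)=1,\quad \frac{dG_0}{dt_1}(0)=1,\ \frac{dG_1}{dt_2}(0)=1,\ \frac{\partial G_2}{\partial t_1}(0,0)=1,\ \frac{\partial G_2}{\partial t_2}(0,0)=1.$$ (ii) The scheme has convergence order seven if, in addition to the conditions in (i), $\frac{\partial H}{\partial t_5}(0,0,0)=0$.
   Context: Divided difference: $f[a,b]=\frac{f(a)-f(b)}{a-b}$ for $a\neq b$. Write $e_n=x_n-\alpha$. Convergence order (at least) $p$ is understood through the error equation: $e_{n+1}=K e_n^{p}+O(e_n^{p+1})$ as $x_n\to\alpha$, where $K$ is a constant depending on $f$, the parameters and the weight functions (which may vanish in special cases). The iteration formulas are understood at steps where all denominators are nonzero. The weight functions are smooth near the origin, with the displayed Taylor expansions there. *)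

theory Defs
  imports "HOL-Analysis.Analysis"
begin

text \<open>
  Meaningful for open \<open>S\<close>: all iterated partial derivatives up to order \<open>k\<close> exist and are
  continuous on \<open>S\<close>. On \<open>real\<close> the only basis vector is \<open>1\<close>, so this is the usual \<open>C^k\<close>.
\<close>
primrec Ck_on :: "nat \<Rightarrow> ('a::euclidean_space \<Rightarrow> real) \<Rightarrow> 'a set \<Rightarrow> bool" where
  "Ck_on 0 f S \<longleftrightarrow> continuous_on S f"
| "Ck_on (Suc k) f S \<longleftrightarrow>
     (\<forall>x\<in>S. f differentiable (at x)) \<and>
     (\<forall>b\<in>Basis. Ck_on k (\<lambda>x. frechet_derivative f (at x) b) S)"

definition smooth_near :: "('a::euclidean_space \<Rightarrow> real) \<Rightarrow> 'a \<Rightarrow> bool" where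
  "smooth_near f a \<longleftrightarrow> (\<exists>U. open U \<and> a \<in> U \<and> (\<forall>k. Ck_on k f U))"

definition divdiff :: "(real \<Rightarrow> real) \<Rightarrow> real \<Rightarrow> real \<Rightarrow> real" where
  "divdiff f a b = (f a - f b) / (a - b)"

definition w_step :: "(real \<Rightarrow> real) \<Rightarrow> real \<Rightarrow> real \<Rightarrow> real" where
  "w_step f \<kappa> x = x - \<kappa> * f x"

definition y_step :: "(real \<Rightarrow> real) \<Rightarrow> real \<Rightarrow> real \<Rightarrow> real" where
  "y_step f \<kappa> x = x - f x / divdiff f x (w_step f \<kappa> x)"

definition z_step :: "(real \<Rightarrow> real) \<Rightarrow> real \<Rightarrow> real \<Rightarrow> real \<Rightarrow>
    (real \<Rightarrow> real) \<Rightarrow> (real \<Rightarrow> real) \<Rightarrow> (real \<Rightarrow> real \<Rightarrow> real) \<Rightarrow> real \<Rightarrow> real" where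
  "z_step f \<kappa> g1 g2 G0 G1 G2 x =
    (let w = w_step f \<kappa> x; y = y_step f \<kappa> x; t1 = f y / f x; t2 = f y / f w in
      y - ((1 - g1 - g2) / divdiff f y w * G0 t1
           + g1 / divdiff f x y * G1 t2
           + g2 / divdiff f x w * G2 t1 t2) * f y)"

definition last_denom :: "(real \<Rightarrow> real) \<Rightarrow> real \<Rightarrow> real \<Rightarrow> real \<Rightarrow> real \<Rightarrow> real \<Rightarrow> real" where
  "last_denom f h x w y z =
     divdiff f z y - (h - 1) * divdiff f z w + h * divdiff f z x
       - h * divdiff f y x + (h - 1) * divdiff f y w"

definition scheme :: "(real \<Rightarrow> real) \<Rightarrow> real \<Rightarrow> real \<Rightarrow> real \<Rightarrow> real \<Rightarrow>
    (real \<Rightarrow> real) \<Rightarrow> (real \<Rightarrow> real) \<Rightarrow> (real \<Rightarrow> real \<Rightarrow> real) \<Rightarrow>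
    (real \<Rightarrow> real \<Rightarrow> real \<Rightarrow> real) \<Rightarrow> real \<Rightarrow> real" where
  "scheme f \<kappa> g1 g2 h G0 G1 G2 H x =
    (let w = w_step f \<kappa> x; y = y_step f \<kappa> x; z = z_step f \<kappa> g1 g2 G0 G1 G2 x in
      z - H (f z / f x) (f z / f w) (f z / f y) * (f z / last_denom f h x w y z))"

text \<open>
  The points at which one step can be carried out: the intermediate points lie in the domain of
  \<open>f\<close> and no denominator vanishes (recall that division by zero yields \<open>0\<close> in HOL, so
  this has to be stated explicitly).
\<close>
definition admissible :: "real set \<Rightarrow> (real \<Rightarrow> real) \<Rightarrow> real \<Rightarrow> real \<Rightarrow> real \<Rightarrow> real \<Rightarrow>
    (real \<Rightarrow> real) \<Rightarrow> (real \<Rightarrow> real) \<Rightarrow> (real \<Rightarrow> real \<Rightarrow> real) \<Rightarrow> real set" where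
  "admissible D f \<kappa> g1 g2 h G0 G1 G2 =
    {x. let w = w_step f \<kappa> x; y = y_step f \<kappa> x; z = z_step f \<kappa> g1 g2 G0 G1 G2 x in
        x \<in> D \<and> w \<in> D \<and> y \<in> D \<and> z \<in> D \<and>
        x \<noteq> w \<and> y \<noteq> w \<and> x \<noteq> y \<and> z \<noteq> y \<and> z \<noteq> w \<and> z \<noteq> x \<and>
        divdiff f x w \<noteq> 0 \<and> divdiff f y w \<noteq> 0 \<and> divdiff f x y \<noteq> 0 \<and>
        f x \<noteq> 0 \<and> f w \<noteq> 0 \<and> f y \<noteq> 0 \<and>
        last_denom f h x w y z \<noteq> 0}"

text \<open>
  The error equation \<open>e\<^sub>n\<^sub>+\<^sub>1 = K e\<^sub>n^p + O(e\<^sub>n^(p+1))\<close> for the iteration map \<open>\<Phi>\<close>, uniformly over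
  all current iterates \<open>x \<rightarrow> \<alpha>\<close> at which the step is defined.
\<close>
definition error_equation ::
    "(real \<Rightarrow> real) \<Rightarrow> real set \<Rightarrow> real \<Rightarrow> nat \<Rightarrow> real \<Rightarrow> bool" where
  "error_equation \<Phi> A \<alpha> p K \<longleftrightarrow>
     (\<lambda>x. (\<Phi> x - \<alpha>) - K * (x - \<alpha>) ^ p) \<in> O[at \<alpha> within A](\<lambda>x. (x - \<alpha>) ^ (p + 1))"

definition locally_convergent :: "(real \<Rightarrow> real) \<Rightarrow> real set \<Rightarrow> real \<Rightarrow> bool" where
  "locally_convergent \<Phi> A \<alpha> \<longleftrightarrow>
     (\<exists>\<delta>>0. \<forall>x :: nat \<Rightarrow> real.
        \<bar>x 0 - \<alpha>\<bar> < \<delta> \<and> (\<forall>n. x n \<in> A \<and> x (Suc n) = \<Phi> (x n)) \<longrightarrow> x \<longlonglongrightarrow> \<alpha>)"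

text \<open>The constant \<open>K\<close> may be zero.\<close>
definition convergence_order_at_least ::
    "(real \<Rightarrow> real) \<Rightarrow> real set \<Rightarrow> real \<Rightarrow> nat \<Rightarrow> bool" where
  "convergence_order_at_least \<Phi> A \<alpha> p \<longleftrightarrow>
     locally_convergent \<Phi> A \<alpha> \<and> (\<exists>K. error_equation \<Phi> A \<alpha> p K)"

end

theory Submission
  imports Defs
begin

text \<open>
  Write \<open>f (\<alpha> + u) = c1 u + c2 u^2 + c3 u^3 + r u\<close>. For \<open>f\<close> of class \<open>C^4\<close> the divided
  differences of \<open>r\<close> at points of size \<open>O(e)\<close> satisfy \<open>r[a, b] = O(e^3)\<close> and
  \<open>r[a, c] - r[b, c] = O((a - b) e^2)\<close>; the second bound stays useful even if \<open>w\<close>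
  approaches the root faster than \<open>x\<close> does (\<open>\<kappa> c1 = 1\<close>). The errors then factor as
  \<open>w = e \<mu>\<close>, \<open>y = e w \<rho>\<close> and \<open>z = y \<sigma>\<close>. The weights \<open>1 + t1\<close>, \<open>1 + t2\<close> and
  \<open>1 + t1 + t2\<close> cancel the linear parts of \<open>f[y, w]\<close>, \<open>f[x, y]\<close> and \<open>f[x, w]\<close>, so
  \<open>\<sigma> = O(e^2)\<close> and \<open>z = O(e^4)\<close>. The last denominator is \<open>c1 + O(e^3)\<close>, so the last
  substep gains the order of \<open>H - 1\<close>, which is \<open>e^2\<close> because of \<open>a8 t5\<close>, and \<open>e^3\<close> if
  \<open>a8 = 0\<close>. Existence of the constant \<open>K\<close> is obtained separately from these bounds: every
  quantity has a polynomial expansion in \<open>e\<close> to the required order, and such expansions are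
  closed under arithmetic.
\<close>

subsection \<open>Finite expansions along a filter\<close>

text \<open>The filter stays abstract so that identities need only hold eventually. In the
  application it is the filter of admissible points near the root, and \<open>e\<close> is the error
  of the current iterate. \<open>nontriv\<close> makes limits, and hence constant coefficients,
  unique.\<close>

locale jets =
  fixes F :: "'a filter" and e :: "'a \<Rightarrow> real"
  assumes nontriv: "F \<noteq> bot" and e_lim: "(e \<longlongrightarrow> 0) F" and e_nz: "eventually (\<lambda>x. e x \<noteq> 0) F"
begin

text \<open>
  \<open>jet k u\<close> says that \<open>u\<close> agrees with some polynomial in \<open>e\<close> up to \<open>O(e ^ k)\<close>.
\<close>
primrec jet :: "nat \<Rightarrow> ('a \<Rightarrow> real) \<Rightarrow> bool" where
  "jet 0 u \<longleftrightarrow> u \<in> O[F](\<lambda>_. 1)"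
| "jet (Suc k) u \<longleftrightarrow> (\<exists>c. jet k (\<lambda>x. (u x - c) / e x))"

section \<open>Landau calculus in powers of \<open>e\<close>\<close>

lemma bigo_1: "e \<in> O[F](\<lambda>_. 1)"
  by (rule bigoI_tendsto[of _ _ 0]) (use e_lim in auto)

lemma bigo_power_mono: "m \<le> n \<Longrightarrow> (\<lambda>x. e x ^ n) \<in> O[F](\<lambda>x. e x ^ m)"
proof -
  assume "m \<le> n"
  then obtain k where n: "n = k + m" by (metis add.commute le_iff_add)
  have "(\<lambda>x. e x ^ k) \<in> O[F](\<lambda>_. 1)"
    using landau_o.big_power[OF bigo_1, of k] by simp
  from landau_o.big.mult[OF this landau_o.big_refl[of "\<lambda>x. e x ^ m" F]]
  show ?thesis by (simp add: n power_add)
qed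

lemma bigo_power_trans: "u \<in> O[F](\<lambda>x. e x ^ n) \<Longrightarrow> m \<le> n \<Longrightarrow> u \<in> O[F](\<lambda>x. e x ^ m)"
  using bigo_power_mono landau_o.big_trans by blast

lemma bigo_power_mult:
  "u \<in> O[F](\<lambda>x. e x ^ m) \<Longrightarrow> v \<in> O[F](\<lambda>x. e x ^ n) \<Longrightarrow> (\<lambda>x. u x * v x) \<in> O[F](\<lambda>x. e x ^ (m + n))"
  by (simp add: power_add landau_o.big.mult)

lemma bigo_power_lim: "u \<in> O[F](\<lambda>x. e x ^ n) \<Longrightarrow> n > 0 \<Longrightarrow> (u \<longlongrightarrow> 0) F"
proof -
  assume *: "u \<in> O[F](\<lambda>x. e x ^ n)" "n > 0"
  have "((\<lambda>x. e x ^ n) \<longlongrightarrow> 0 ^ n) F" by (intro tendsto_power e_lim)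
  with *(2) have "((\<lambda>x. e x ^ n) \<longlongrightarrow> 0) F" by (simp add: zero_power)
  moreover from *(1) obtain c where "eventually (\<lambda>x. norm (u x) \<le> norm (e x ^ n) * c) F"
    by (auto simp: bigo_def mult.commute)
  ultimately show ?thesis by (rule tendsto_0_le)
qed

lemma bigo_of_e_mult: "u \<in> O[F](\<lambda>_. 1) \<Longrightarrow> (\<lambda>x. e x ^ m * u x) \<in> O[F](\<lambda>x. e x ^ m)"
  using landau_o.big.mult[OF landau_o.big_refl[of "\<lambda>x. e x ^ m" F]] by fastforce

lemma bigo_lim: "(u \<longlongrightarrow> c) F \<Longrightarrow> u \<in> O[F](\<lambda>_. 1)" for c :: real
  by (rule bigoI_tendsto[of _ _ c]) auto

lemma bigo_mult_1: "u \<in> O[F](\<lambda>x. e x ^ m) \<Longrightarrow> v \<in> O[F](\<lambda>_. 1) \<Longrightarrow> (\<lambda>x. u x * v x) \<in> O[F](\<lambda>x. e x ^ m)"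
  using landau_o.big.mult[of u F "\<lambda>x. e x ^ m" v "\<lambda>_. 1"] by simp

lemma bigo_cmult:
  fixes c :: real
  assumes "u \<in> O[F](\<lambda>x. e x ^ m)" shows "(\<lambda>x. c * u x) \<in> O[F](\<lambda>x. e x ^ m)"
  using landau_o.big.mult[OF bigo_const[of c] assms] by simp

lemma bigo_power_of:
  assumes "u \<in> O[F](\<lambda>x. e x ^ m)" shows "(\<lambda>x. u x ^ n) \<in> O[F](\<lambda>x. e x ^ (m * n))"
  using landau_o.big_power[OF assms, of n] by (simp add: power_mult)

lemma norm_Pair_bigo:
  fixes u :: "'a \<Rightarrow> 'b::real_normed_vector" and v :: "'a \<Rightarrow> 'c::real_normed_vector"
  assumes "(\<lambda>x. norm (u x)) \<in> O[F](\<lambda>x. e x ^ m)" "(\<lambda>x. norm (v x)) \<in> O[F](\<lambda>x. e x ^ m)"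
  shows "(\<lambda>x. norm (u x, v x)) \<in> O[F](\<lambda>x. e x ^ m)"
proof -
  have "(\<lambda>x. norm (u x, v x)) \<in> O[F](\<lambda>x. norm (u x) + norm (v x))"
    by (rule bigoI[of _ 1]) (simp add: norm_Pair_le)
  also have "(\<lambda>x. norm (u x) + norm (v x)) \<in> O[F](\<lambda>x. e x ^ m)"
    using assms by (intro sum_in_bigo)
  finally show ?thesis .
qed

section \<open>Algebra of finite expansions\<close>

lemma jet_cong: "eventually (\<lambda>x. u x = v x) F \<Longrightarrow> jet k u \<Longrightarrow> jet k v"
proof (induction k arbitrary: u v)
  case 0 then show ?case using landau_o.big.in_cong by fastforce
next
  case (Suc k)
  from Suc.prems(2) obtain c where "jet k (\<lambda>x. (u x - c) / e x)" by auto
  moreover have "eventually (\<lambda>x. (u x - c) / e x = (v x - c) / e x) F"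
    using Suc.prems(1) by eventually_elim simp
  ultimately have "jet k (\<lambda>x. (v x - c) / e x)" by (rule Suc.IH[rotated])
  then show ?case by auto
qed

text \<open>Together with \<open>jet_SucE\<close> this trades the quotient in the recursion for
  \<open>u = c + e v\<close>, the form in which the closure proofs peel off constant terms.\<close>

lemma jet_SucI: "jet k v \<Longrightarrow> eventually (\<lambda>x. u x = c + e x * v x) F \<Longrightarrow> jet (Suc k) u"
proof -
  assume *: "jet k v" "eventually (\<lambda>x. u x = c + e x * v x) F"
  have "eventually (\<lambda>x. v x = (u x - c) / e x) F" using *(2) e_nz by eventually_elim auto
  from jet_cong[OF this *(1)] show ?thesis by auto
qed

lemma jet_SucE:
  assumes "jet (Suc k) u"
  obtains c v where "jet k v" "eventually (\<lambda>x. u x = c + e x * v x) F"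
proof -
  from assms obtain c where c: "jet k (\<lambda>x. (u x - c) / e x)" by auto
  have "eventually (\<lambda>x. u x = c + e x * ((u x - c) / e x)) F"
    using e_nz by eventually_elim auto
  with c that show ?thesis by blast
qed

lemma jet_bounded: "jet k u \<Longrightarrow> u \<in> O[F](\<lambda>_. 1)"
proof (induction k arbitrary: u)
  case (Suc k)
  then obtain c v where "jet k v" and u: "eventually (\<lambda>x. u x = c + e x * v x) F"
    by (blast elim: jet_SucE)
  then have "v \<in> O[F](\<lambda>_. 1)" using Suc.IH by blast
  then have "(\<lambda>x. e x * v x) \<in> O[F](\<lambda>_. 1)"
    using landau_o.big.mult[OF bigo_1] by fastforce
  then have "(\<lambda>x. c + e x * v x) \<in> O[F](\<lambda>_. 1)" by (intro sum_in_bigo) auto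
  then show ?case using landau_o.big.in_cong[OF u] by auto
qed simp

lemma jet_e_mult: "jet k u \<Longrightarrow> jet (Suc k) (\<lambda>x. e x * u x)"
  by (rule jet_SucI[of k u _ 0]) auto

lemma jet_e_power_mult: "jet k u \<Longrightarrow> jet (m + k) (\<lambda>x. e x ^ m * u x)"
proof (induction m)
  case (Suc m)
  then show ?case using jet_e_mult[of "m + k" "\<lambda>x. e x ^ m * u x"] by (simp add: mult.assoc del: jet.simps)
qed simp

text \<open>The approximating polynomial is zero; each division by \<open>e\<close> lowers the
  exponent by one.\<close>

lemma jet_bigo: "u \<in> O[F](\<lambda>x. e x ^ k) \<Longrightarrow> jet k u"
proof (induction k arbitrary: u)
  case (Suc k)
  have "(\<lambda>x. u x / e x) \<in> O[F](\<lambda>x. e x ^ Suc k / e x)"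
    using e_nz Suc.prems by (rule landau_o.big.divide_right)
  also have "(\<lambda>x. e x ^ Suc k / e x) \<in> O[F](\<lambda>x. e x ^ k)"
    by (rule bigoI[of _ 1]) (use e_nz in \<open>auto elim: eventually_mono\<close>)
  finally have "jet k (\<lambda>x. u x / e x)" by (rule Suc.IH)
  then have "jet k (\<lambda>x. (u x - 0) / e x)" by simp
  then show ?case unfolding jet.simps by blast
qed simp

lemma jet_0: "jet k (\<lambda>_. 0)"
  by (rule jet_bigo) simp

lemma jet_const: "jet k (\<lambda>_. c)"
proof (cases k)
  case (Suc n)
  have "jet n (\<lambda>x. (c - c) / e x)" using jet_0 by simp
  then show ?thesis unfolding Suc jet.simps by blast
qed simp

lemma jet_e: "jet k e"
proof (cases k)
  case (Suc n)
  then show ?thesis using jet_e_mult[OF jet_const[of n 1]] by (simp del: jet.simps)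
qed (simp add: bigo_1)

lemma jet_add: "jet k u \<Longrightarrow> jet k v \<Longrightarrow> jet k (\<lambda>x. u x + v x)"
proof (induction k arbitrary: u v)
  case 0 then show ?case by (simp add: sum_in_bigo)
next
  case (Suc k)
  from Suc.prems obtain c u' d v' where *: "jet k u'" "eventually (\<lambda>x. u x = c + e x * u' x) F"
    "jet k v'" "eventually (\<lambda>x. v x = d + e x * v' x) F" by (metis jet_SucE)
  from *(2,4) have "eventually (\<lambda>x. u x + v x = (c + d) + e x * (u' x + v' x)) F"
    by eventually_elim (simp add: algebra_simps)
  with Suc.IH[OF *(1,3)] show ?case by (rule jet_SucI)
qed

lemma jet_Suc_imp: "jet (Suc k) u \<Longrightarrow> jet k u"
proof (induction k arbitrary: u)
  case 0 then show ?case using jet_bounded[of "Suc 0" u] by simp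
next
  case (Suc k)
  from Suc.prems obtain c v where "jet (Suc k) v" "eventually (\<lambda>x. u x = c + e x * v x) F"
    by (metis jet_SucE)
  from jet_SucI[OF Suc.IH[OF this(1)] this(2)] show ?case .
qed

lemma jet_mono: "jet n u \<Longrightarrow> m \<le> n \<Longrightarrow> jet m u"
proof (induction n)
  case (Suc n)
  then show ?case using jet_Suc_imp[of n u] by (metis le_Suc_eq)
qed simp

lemma jet_mult: "jet k u \<Longrightarrow> jet k v \<Longrightarrow> jet k (\<lambda>x. u x * v x)"
proof (induction k arbitrary: u v)
  case 0 then show ?case using landau_o.big.mult by fastforce
next
  case (Suc k)
  from Suc.prems obtain c u' d v' where *: "jet k u'" "eventually (\<lambda>x. u x = c + e x * u' x) F"
    "jet k v'" "eventually (\<lambda>x. v x = d + e x * v' x) F" by (metis jet_SucE)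
  \<comment> \<open>The factor \<open>v\<close> is kept whole in the cross term:
    \<open>u v = c d + e (u' v + c v')\<close>. Only products of order \<open>k\<close> remain, so
    the induction hypothesis applies.\<close>
  have "jet k (\<lambda>x. u' x * v x + c * v' x)"
    using * Suc.prems by (intro jet_add Suc.IH jet_const) (auto dest: jet_Suc_imp simp del: jet.simps)
  moreover from *(2,4) have "eventually (\<lambda>x. u x * v x = c * d + e x * (u' x * v x + c * v' x)) F"
    by eventually_elim (simp add: algebra_simps)
  ultimately show ?case by (rule jet_SucI)
qed

lemma jet_diff: "jet k u \<Longrightarrow> jet k v \<Longrightarrow> jet k (\<lambda>x. u x - v x)"
  using jet_add[of k u "\<lambda>x. -1 * v x"] jet_mult[OF jet_const[of k "-1"]] by simp

lemma jet_power: "jet k u \<Longrightarrow> jet k (\<lambda>x. u x ^ n)"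
  by (induction n) (auto intro: jet_const jet_mult)

text \<open>The constant coefficient of an expansion is the limit of the expanded quantity, so a
  known limit may be prescribed as coefficient.\<close>

lemma jet_lead: "jet (Suc k) u \<Longrightarrow> (u \<longlongrightarrow> c) F \<Longrightarrow> \<exists>v. jet k v \<and> eventually (\<lambda>x. u x = c + e x * v x) F"
proof -
  assume *: "jet (Suc k) u" "(u \<longlongrightarrow> c) F"
  then obtain d v where v: "jet k v" "eventually (\<lambda>x. u x = d + e x * v x) F" by (metis jet_SucE)
  have "(\<lambda>x. e x * v x) \<in> O[F](\<lambda>x. e x ^ 1)"
    using landau_o.big.mult[OF landau_o.big_refl[of e F] jet_bounded[OF v(1)]] by simp
  then have "((\<lambda>x. d + e x * v x) \<longlongrightarrow> d + 0) F"
    by (intro tendsto_add tendsto_const bigo_power_lim[of _ 1]) auto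
  then have "(u \<longlongrightarrow> d) F" using v(2) by (simp add: tendsto_cong)
  with *(2) have "d = c" using nontriv tendsto_unique by blast
  with v show ?thesis by blast
qed

lemma jet_limit: "jet (Suc k) u \<Longrightarrow> (u \<longlongrightarrow> c) F \<Longrightarrow> (\<lambda>x. u x - c) \<in> O[F](\<lambda>x. e x ^ 1)"
proof -
  assume "jet (Suc k) u" "(u \<longlongrightarrow> c) F"
  from jet_lead[OF this] obtain v where v: "jet k v" "eventually (\<lambda>x. u x = c + e x * v x) F" by blast
  have "(\<lambda>x. e x * v x) \<in> O[F](\<lambda>x. e x ^ 1)"
    using landau_o.big.mult[OF landau_o.big_refl[of e F] jet_bounded[OF v(1)]] by simp
  moreover have ev: "eventually (\<lambda>x. u x - c = e x * v x) F" using v(2) by eventually_elim simp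
  ultimately show ?thesis using landau_o.big.in_cong[OF ev] by simp
qed

lemma jet_inverse:
  assumes "(v \<longlongrightarrow> c) F" "c \<noteq> 0"
  shows "jet k v \<Longrightarrow> jet k (\<lambda>x. 1 / v x)"
proof (induction k)
  case 0
  have "((\<lambda>x. 1 / v x) \<longlongrightarrow> 1 / c) F" using assms by (intro tendsto_intros)
  then show ?case by (auto intro: bigoI_tendsto)
next
  case (Suc k)
  from jet_lead[OF Suc.prems assms(1)]
  obtain u where u: "jet k u" "eventually (\<lambda>x. v x = c + e x * u x) F" by blast
  \<comment> \<open>From \<open>v = c + e u\<close> follows
    \<open>1 / v = 1 / c - (e / c) u (1 / v)\<close>. On the right \<open>1 / v\<close> is needed
    one order lower, which the induction hypothesis provides.\<close>
  have "jet k (\<lambda>x. (-1/c) * (u x * (1 / v x)))"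
    using u Suc.prems by (intro jet_mult Suc.IH jet_const) (auto dest: jet_Suc_imp simp del: jet.simps)
  moreover have "eventually (\<lambda>x. v x \<noteq> 0) F" using assms tendsto_imp_eventually_ne by blast
  then have "eventually (\<lambda>x. 1 / v x = 1 / c + e x * ((-1/c) * (u x * (1 / v x)))) F" using u(2)
  proof eventually_elim
    case (elim x)
    then have "e x * u x = v x - c" by simp
    then have "e x * ((-1/c) * (u x * (1 / v x))) = (-1/c) * ((v x - c) / v x)" by simp
    also have "1 / c + \<dots> = 1 / v x" using elim(1) assms(2) by (simp add: field_simps)
    finally show ?case ..
  qed
  ultimately show ?case by (rule jet_SucI)
qed

lemma jet_divide: "jet k u \<Longrightarrow> jet k v \<Longrightarrow> (v \<longlongrightarrow> c) F \<Longrightarrow> c \<noteq> 0 \<Longrightarrow> jet k (\<lambda>x. u x / v x)"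
  using jet_mult[of k u "\<lambda>x. 1 / v x"] jet_inverse[of v c k] by simp

text \<open>Division by \<open>e ^ m\<close> costs \<open>m\<close> orders. The Landau bound makes
  the first \<open>m\<close> coefficients vanish, because at each stage the limit is
  \<open>0\<close>.\<close>

lemma jet_divide_power: "jet (m + k) u \<Longrightarrow> u \<in> O[F](\<lambda>x. e x ^ m) \<Longrightarrow> jet k (\<lambda>x. u x / e x ^ m)"
proof (induction m arbitrary: u)
  case (Suc m)
  have "(u \<longlongrightarrow> 0) F" using Suc.prems(2) by (rule bigo_power_lim) simp
  then obtain v where v: "jet (m + k) v" "eventually (\<lambda>x. u x = 0 + e x * v x) F"
    using jet_lead[of "m + k" u 0] Suc.prems(1) by (auto simp del: jet.simps)
  have ev: "eventually (\<lambda>x. u x / e x = v x) F" using v(2) e_nz by eventually_elim auto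
  have "(\<lambda>x. u x / e x) \<in> O[F](\<lambda>x. e x ^ Suc m / e x)"
    using e_nz Suc.prems(2) by (rule landau_o.big.divide_right)
  also have "(\<lambda>x. e x ^ Suc m / e x) \<in> O[F](\<lambda>x. e x ^ m)"
    by (rule bigoI[of _ 1]) (use e_nz in \<open>auto elim: eventually_mono\<close>)
  finally have "v \<in> O[F](\<lambda>x. e x ^ m)" using landau_o.big.in_cong[OF ev] by simp
  with Suc.IH v(1) have "jet k (\<lambda>x. v x / e x ^ m)" by blast
  moreover have "eventually (\<lambda>x. v x / e x ^ m = u x / e x ^ Suc m) F"
    using v(2) e_nz by eventually_elim auto
  ultimately show ?case by (rule jet_cong[rotated])
qed simp

text \<open>The cancellation behind every gain of order: \<open>q\<close> and \<open>G\<close> share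
  the relative first-order part \<open>s\<close>, so \<open>q - d G\<close> splits exactly into
  \<open>(q - c - c s) - (d - c) G - c (G - 1 - s)\<close>, three small terms. It serves the third
  substep with \<open>s\<close> equal to \<open>t1\<close>, \<open>t2\<close> and
  \<open>t1 + t2\<close>, and the last one with \<open>s = 0\<close>.\<close>

lemma corrector:
  assumes q: "(q \<longlongrightarrow> c) F" and "c \<noteq> 0" and q_s: "(\<lambda>x. q x - c - c * s x) \<in> O[F](\<lambda>x. e x ^ m)"
    and G: "(G \<longlongrightarrow> 1) F" and G_s: "(\<lambda>x. G x - 1 - s x) \<in> O[F](\<lambda>x. e x ^ m)"
    and d: "(\<lambda>x. d x - c) \<in> O[F](\<lambda>x. e x ^ m)"
  shows "(\<lambda>x. 1 - d x / q x * G x) \<in> O[F](\<lambda>x. e x ^ m)"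
proof -
  have "(\<lambda>x. (q x - c - c * s x) - (d x - c) * G x - c * (G x - 1 - s x)) \<in> O[F](\<lambda>x. e x ^ m)"
    using sum_in_bigo(2)[OF sum_in_bigo(2)[OF q_s bigo_mult_1[OF d bigo_lim[OF G]]]
      landau_o.big.cmult_in_iff[THEN iffD2, OF \<open>c \<noteq> 0\<close> G_s]] .
  moreover have "((\<lambda>x. 1 / q x) \<longlongrightarrow> 1 / c) F" using q \<open>c \<noteq> 0\<close> by (intro tendsto_intros)
  ultimately have "(\<lambda>x. ((q x - c - c * s x) - (d x - c) * G x - c * (G x - 1 - s x)) * (1 / q x)) \<in> O[F](\<lambda>x. e x ^ m)"
    by (intro bigo_mult_1 bigo_lim)
  moreover have "eventually (\<lambda>x. q x \<noteq> 0) F" using q \<open>c \<noteq> 0\<close> tendsto_imp_eventually_ne by blast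
  then have "eventually (\<lambda>x. ((q x - c - c * s x) - (d x - c) * G x - c * (G x - 1 - s x)) * (1 / q x)
    = 1 - d x / q x * G x) F"
    by eventually_elim (simp add: divide_simps, simp add: algebra_simps)
  from landau_o.big.in_cong[OF this] calculation show ?thesis by blast
qed

end

subsection \<open>Divided differences of a fourth-order remainder\<close>

lemma Ck_on_SucD:
  fixes f :: "real \<Rightarrow> real"
  assumes "Ck_on (Suc k) f S"
  obtains f' where "\<And>x. x \<in> S \<Longrightarrow> (f has_real_derivative f' x) (at x)" "Ck_on k f' S"
proof
  let ?f' = "\<lambda>x. frechet_derivative f (at x) 1"
  show "Ck_on k ?f' S" using assms by simp
  fix x assume "x \<in> S"
  then have f: "(f has_derivative frechet_derivative f (at x)) (at x)"
    using assms frechet_derivative_works by auto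
  have "frechet_derivative f (at x) = (*) (?f' x)"
  proof
    fix h :: real
    have "frechet_derivative f (at x) (h *\<^sub>R 1) = h *\<^sub>R ?f' x"
      by (rule linear_cmul[OF has_derivative_linear[OF f]])
    then show "frechet_derivative f (at x) h = ?f' x * h" by simp
  qed
  with f show "(f has_real_derivative ?f' x) (at x)"
    unfolding has_field_derivative_def by (rule has_derivative_eq_rhs)
qed

text \<open>Mean value inequality on the ball of radius \<open>\<bar>u\<bar>\<close>. The factor
  \<open>1 / (n + 1)\<close> of a true integration is given away, so that one constant
  \<open>C\<close> serves every iteration.\<close>

lemma power_bound_integrate:
  fixes g g' :: "real \<Rightarrow> real"
  assumes der: "\<And>u. \<bar>u\<bar> < \<delta> \<Longrightarrow> (g has_real_derivative g' u) (at u)"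
    and bound: "\<And>u. \<bar>u\<bar> < \<delta> \<Longrightarrow> \<bar>g' u\<bar> \<le> C * \<bar>u\<bar> ^ n"
    and "g 0 = 0" "C \<ge> 0" and u: "\<bar>u\<bar> < \<delta>"
  shows "\<bar>g u\<bar> \<le> C * \<bar>u\<bar> ^ Suc n"
proof -
  have "norm (g u - g 0) \<le> (C * \<bar>u\<bar> ^ n) * norm (u - 0)"
  proof (rule field_differentiable_bound[where f' = g' and S = "cball 0 \<bar>u\<bar>"])
    fix v :: real assume "v \<in> cball 0 \<bar>u\<bar>"
    then have v: "\<bar>v\<bar> \<le> \<bar>u\<bar>" by simp
    with u have "\<bar>v\<bar> < \<delta>" by linarith
    from has_field_derivative_at_within[OF der[OF this]]
    show "(g has_real_derivative g' v) (at v within cball 0 \<bar>u\<bar>)" .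
    have "\<bar>g' v\<bar> \<le> C * \<bar>v\<bar> ^ n" using \<open>\<bar>v\<bar> < \<delta>\<close> by (rule bound)
    also have "\<dots> \<le> C * \<bar>u\<bar> ^ n" using v \<open>C \<ge> 0\<close> by (intro mult_left_mono power_mono) simp_all
    finally show "norm (g' v) \<le> C * \<bar>u\<bar> ^ n" by simp
  qed simp_all
  then show ?thesis using \<open>g 0 = 0\<close> by (simp add: mult_ac)
qed

text \<open>The fourth derivative is bounded near the root by continuity. Two integrations give the
  bound for \<open>r''\<close> and a third the bound for \<open>r'\<close>.\<close>

lemma Ck4_cubic_remainder:
  fixes f :: "real \<Rightarrow> real"
  assumes "open D" "Ck_on 4 f D" "\<alpha> \<in> D" "f \<alpha> = 0"
  obtains \<delta> C r c2 c3 r' r'' where "\<delta> > 0" "C > 0" "r 0 = 0"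
    "\<And>u. f (\<alpha> + u) = deriv f \<alpha> * u + c2 * u ^ 2 + c3 * u ^ 3 + r u"
    "\<And>u. \<bar>u\<bar> < \<delta> \<Longrightarrow> (r has_real_derivative r' u) (at u)"
    "\<And>u. \<bar>u\<bar> < \<delta> \<Longrightarrow> (r' has_real_derivative r'' u) (at u)"
    "\<And>u. \<bar>u\<bar> < \<delta> \<Longrightarrow> \<bar>r' u\<bar> \<le> C * \<bar>u\<bar> ^ 3"
    "\<And>u. \<bar>u\<bar> < \<delta> \<Longrightarrow> \<bar>r'' u\<bar> \<le> C * \<bar>u\<bar> ^ 2"
proof -
  have "Ck_on (Suc (Suc (Suc (Suc 0)))) f D" using assms(2) by (simp add: numeral_eq_Suc del: Ck_on.simps)
  then obtain f1 f2 f3 f4 where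
    f: "\<And>x. x \<in> D \<Longrightarrow> (f has_real_derivative f1 x) (at x)"
      "\<And>x. x \<in> D \<Longrightarrow> (f1 has_real_derivative f2 x) (at x)"
      "\<And>x. x \<in> D \<Longrightarrow> (f2 has_real_derivative f3 x) (at x)"
      "\<And>x. x \<in> D \<Longrightarrow> (f3 has_real_derivative f4 x) (at x)"
    and "Ck_on 0 f4 D" by (metis Ck_on_SucD)
  then have cont: "continuous_on D f4" by simp
  obtain \<delta>1 where "\<delta>1 > 0" "ball \<alpha> \<delta>1 \<subseteq> D" using assms by (meson open_contains_ball)
  moreover have "eventually (\<lambda>x. dist (f4 x) (f4 \<alpha>) < 1) (nhds \<alpha>)"
    using cont assms by (intro tendstoD) (auto simp: continuous_on_eq_continuous_at isCont_def tendsto_at_iff_tendsto_nhds)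
  then obtain \<delta>2 where "\<delta>2 > 0" "\<And>x. dist x \<alpha> < \<delta>2 \<Longrightarrow> dist (f4 x) (f4 \<alpha>) < 1"
    unfolding eventually_nhds_metric by blast
  ultimately obtain \<delta> where \<delta>: "\<delta> > 0" "\<And>u. \<bar>u\<bar> < \<delta> \<Longrightarrow> \<alpha> + u \<in> D"
    "\<And>u. \<bar>u\<bar> < \<delta> \<Longrightarrow> \<bar>f4 (\<alpha> + u)\<bar> \<le> 1 + \<bar>f4 \<alpha>\<bar>"
  proof (intro that[of "min \<delta>1 \<delta>2"])
    fix u assume u: "\<bar>u\<bar> < min \<delta>1 \<delta>2" and *: "ball \<alpha> \<delta>1 \<subseteq> D" "\<And>x. dist x \<alpha> < \<delta>2 \<Longrightarrow> dist (f4 x) (f4 \<alpha>) < 1"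
    from u * show "\<alpha> + u \<in> D" by (auto simp: subset_iff dist_real_def)
    from u *(2)[of "\<alpha> + u"] show "\<bar>f4 (\<alpha> + u)\<bar> \<le> 1 + \<bar>f4 \<alpha>\<bar>" by (auto simp: dist_real_def)
  qed auto
  define c2 c3 where "c2 = f2 \<alpha> / 2" and "c3 = f3 \<alpha> / 6"
  \<comment> \<open>On the chosen neighbourhood \<open>f4\<close> differs from
    \<open>f4 \<alpha>\<close> by less than \<open>1\<close>.\<close>
  define C where "C = 1 + \<bar>f4 \<alpha>\<bar>"
  \<comment> \<open>\<open>r\<close> is \<open>f\<close> minus its cubic Taylor polynomial and
    \<open>r1\<close>, \<open>r2\<close>, \<open>r3\<close> are its successive derivatives. All
    vanish at \<open>0\<close>, as the integrations require.\<close>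
  define r where "r u = f (\<alpha> + u) - f1 \<alpha> * u - c2 * u ^ 2 - c3 * u ^ 3" for u
  define r1 where "r1 u = f1 (\<alpha> + u) - f1 \<alpha> - 2 * c2 * u - 3 * c3 * u ^ 2" for u
  define r2 where "r2 u = f2 (\<alpha> + u) - 2 * c2 - 6 * c3 * u" for u
  define r3 where "r3 u = f3 (\<alpha> + u) - 6 * c3" for u
  have shift: "((\<lambda>z. g (\<alpha> + z)) has_real_derivative d) (at u)"
    if "(g has_real_derivative d) (at (\<alpha> + u))" for g d u
    using that DERIV_shift[of g d u \<alpha>] by (simp add: add.commute)
  have d0: "(r has_real_derivative r1 u) (at u)" if "\<bar>u\<bar> < \<delta>" for u
    unfolding r_def r1_def
    by (auto intro!: derivative_eq_intros shift[OF f(1)[OF \<delta>(2)[OF that]]] simp: power2_eq_square)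
  have d1: "(r1 has_real_derivative r2 u) (at u)" if "\<bar>u\<bar> < \<delta>" for u
    unfolding r1_def r2_def
    by (auto intro!: derivative_eq_intros shift[OF f(2)[OF \<delta>(2)[OF that]]])
  have d2: "(r2 has_real_derivative r3 u) (at u)" if "\<bar>u\<bar> < \<delta>" for u
    unfolding r2_def r3_def
    by (auto intro!: derivative_eq_intros shift[OF f(3)[OF \<delta>(2)[OF that]]])
  have d3: "(r3 has_real_derivative f4 (\<alpha> + u)) (at u)" if "\<bar>u\<bar> < \<delta>" for u
    unfolding r3_def
    by (auto intro!: derivative_eq_intros shift[OF f(4)[OF \<delta>(2)[OF that]]])
  have C: "C \<ge> 0" by (simp add: C_def)
  have b3: "\<bar>r3 u\<bar> \<le> C * \<bar>u\<bar> ^ Suc 0" if "\<bar>u\<bar> < \<delta>" for u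
    using d3 _ _ C that by (rule power_bound_integrate) (use \<delta>(3) in \<open>auto simp: C_def r3_def c3_def\<close>)
  have b2: "\<bar>r2 u\<bar> \<le> C * \<bar>u\<bar> ^ Suc (Suc 0)" if "\<bar>u\<bar> < \<delta>" for u
    using d2 b3 _ C that by (rule power_bound_integrate) (auto simp: r2_def c2_def)
  have b1: "\<bar>r1 u\<bar> \<le> C * \<bar>u\<bar> ^ Suc (Suc (Suc 0))" if "\<bar>u\<bar> < \<delta>" for u
    using d1 b2 _ C that by (rule power_bound_integrate) (auto simp: r1_def)
  show ?thesis
  proof (rule that[of \<delta> C r c2 c3 r1 r2])
    have "deriv f \<alpha> = f1 \<alpha>" by (intro DERIV_imp_deriv f(1) assms(3))
    then show "f (\<alpha> + u) = deriv f \<alpha> * u + c2 * u ^ 2 + c3 * u ^ 3 + r u" for u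
      by (simp add: r_def)
  qed (use \<delta>(1) d0 d1 b1 b2 assms(4) in \<open>auto simp: C_def r_def eval_nat_numeral\<close>)
qed

section \<open>Mean value bounds for divided differences\<close>

lemma divdiff_bound:
  assumes der: "\<And>u. \<bar>u\<bar> < \<delta> \<Longrightarrow> (r has_real_derivative r' u) (at u)"
    and bound: "\<And>u. \<bar>u\<bar> < m' \<Longrightarrow> \<bar>r' u\<bar> \<le> B"
    and "\<bar>a\<bar> < m'" "\<bar>b\<bar> < m'" "m' \<le> \<delta>"
  shows "\<bar>divdiff r a b\<bar> \<le> B"
proof -
  have "norm (r a - r b) \<le> B * norm (a - b)"
  proof (rule field_differentiable_bound[where f' = r' and S = "ball 0 m'"])
    fix v :: real assume "v \<in> ball 0 m'"
    with assms show "(r has_real_derivative r' v) (at v within ball 0 m')" "norm (r' v) \<le> B"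
      by (auto intro: has_field_derivative_at_within)
  qed (use assms in auto)
  \<comment> \<open>This settles the case \<open>a = b\<close>, where the divided difference is
    \<open>0 / 0 = 0\<close>.\<close>
  moreover have "B \<ge> 0" using bound[of a] assms(3) by force
  ultimately show ?thesis by (cases "a = b") (simp_all add: divdiff_def field_simps)
qed

text \<open>
  The mean value theorem for \<open>t \<mapsto> r (c + t (a - c)) / (a - c) - r (c + t (b - c)) / (b - c)\<close>
  on \<open>[0, 1]\<close> covers all orderings of \<open>a\<close>, \<open>b\<close>, \<open>c\<close> at once.
\<close>
lemma divdiff_diff_bound:
  assumes der: "\<And>u. \<bar>u\<bar> < m \<Longrightarrow> (r has_real_derivative r' u) (at u)"
    and der': "\<And>u. \<bar>u\<bar> < m \<Longrightarrow> (r' has_real_derivative r'' u) (at u)"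
    and bound: "\<And>u. \<bar>u\<bar> < m \<Longrightarrow> \<bar>r'' u\<bar> \<le> B"
    and m: "\<bar>a\<bar> < m" "\<bar>b\<bar> < m" "\<bar>c\<bar> < m" and "a \<noteq> c" "b \<noteq> c"
  shows "\<bar>divdiff r a c - divdiff r b c\<bar> \<le> B * \<bar>a - b\<bar>"
proof -
  define q where "q t = r (c + t * (a - c)) / (a - c) - r (c + t * (b - c)) / (b - c)" for t
  have seg: "\<bar>c + t * (x - c)\<bar> < m" if "\<bar>x\<bar> < m" "0 \<le> t" "t \<le> 1" for t x
  proof -
    have "c + t * (x - c) \<in> closed_segment c x"
      unfolding in_segment using that by (intro exI[of _ t]) (auto simp: algebra_simps)
    moreover have "closed_segment c x \<subseteq> ball 0 m"
      using m that by (intro closed_segment_subset) auto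
    ultimately show ?thesis by auto
  qed
  have "\<exists>t>0. t < 1 \<and> q 1 - q 0 = (1 - 0) * (r' (c + t * (a - c)) - r' (c + t * (b - c)))"
  proof (rule MVT2)
    fix t :: real assume "0 \<le> t" "t \<le> 1"
    with seg m show "(q has_real_derivative r' (c + t * (a - c)) - r' (c + t * (b - c))) (at t)"
      unfolding q_def using assms(7,8)
      by (auto intro!: derivative_eq_intros DERIV_chain2[OF der])
  qed simp
  then obtain t where t: "0 < t" "t < 1"
    "q 1 - q 0 = r' (c + t * (a - c)) - r' (c + t * (b - c))" by auto
  \<comment> \<open>Both segments start at \<open>c\<close> and are evaluated at the same
    \<open>t\<close>, so the two points differ by \<open>t (a - b)\<close>; this is the source of
    the factor \<open>a - b\<close>.\<close>
  have "norm (r' (c + t * (a - c)) - r' (c + t * (b - c))) \<le> B * norm ((c + t * (a - c)) - (c + t * (b - c)))"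
  proof (rule field_differentiable_bound[where f' = r'' and S = "ball 0 m"])
    fix v :: real assume "v \<in> ball 0 m"
    with der' bound show "(r' has_real_derivative r'' v) (at v within ball 0 m)" "norm (r'' v) \<le> B"
      by (auto intro: has_field_derivative_at_within)
  qed (use seg m t in auto)
  also have "(c + t * (a - c)) - (c + t * (b - c)) = t * (a - b)" by (simp add: algebra_simps)
  also have "B * norm (t * (a - b)) \<le> B * \<bar>a - b\<bar>"
  proof (intro mult_left_mono)
    show "norm (t * (a - b)) \<le> \<bar>a - b\<bar>" using t by (simp add: abs_mult mult_left_le_one_le)
    show "B \<ge> 0" using bound[of a] m by force
  qed
  finally have "\<bar>q 1 - q 0\<bar> \<le> B * \<bar>a - b\<bar>" using t by simp
  moreover have "q 1 - q 0 = divdiff r a c - divdiff r b c"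
    by (simp add: q_def divdiff_def diff_divide_distrib)
  ultimately show ?thesis by simp
qed

lemma divdiff_commute: "divdiff f a b = divdiff f b a"
  unfolding divdiff_def by (metis minus_diff_eq minus_divide_divide)

section \<open>The function shifted to a simple root at zero\<close>

text \<open>The assumptions are the output of \<open>Ck4_cubic_remainder\<close> for
  \<open>g u = f (\<alpha> + u)\<close>, with \<open>c1\<close> the derivative at the root.\<close>

locale cubic_root = jets F e for F :: "'a filter" and e :: "'a \<Rightarrow> real" +
  fixes g r r' r'' :: "real \<Rightarrow> real" and c1 c2 c3 C \<delta> :: real
  assumes g_eq: "\<And>u. g u = c1 * u + c2 * u ^ 2 + c3 * u ^ 3 + r u"
    and c1: "c1 \<noteq> 0" and pos: "\<delta> > 0" "C > 0" and r_0: "r 0 = 0"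
    and der: "\<And>u. \<bar>u\<bar> < \<delta> \<Longrightarrow> (r has_real_derivative r' u) (at u)"
    and der': "\<And>u. \<bar>u\<bar> < \<delta> \<Longrightarrow> (r' has_real_derivative r'' u) (at u)"
    and bound': "\<And>u. \<bar>u\<bar> < \<delta> \<Longrightarrow> \<bar>r' u\<bar> \<le> C * \<bar>u\<bar> ^ 3"
    and bound'': "\<And>u. \<bar>u\<bar> < \<delta> \<Longrightarrow> \<bar>r'' u\<bar> \<le> C * \<bar>u\<bar> ^ 2"
begin

text \<open>Finds a common open ball for three points, of radius comparable to \<open>e ^ m\<close>
  and eventually inside the domain of the bounds. \<open>K\<close> is the sum of three Landau
  constants; strictness comes from \<open>e \<noteq> 0\<close>.\<close>

lemma bigo_radius:
  assumes "a \<in> O[F](\<lambda>x. e x ^ m)" "b \<in> O[F](\<lambda>x. e x ^ m)" "c \<in> O[F](\<lambda>x. e x ^ m)" "m > 0"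
  obtains K where "K > 0" "eventually (\<lambda>x. \<bar>a x\<bar> < K * \<bar>e x ^ m\<bar> \<and> \<bar>b x\<bar> < K * \<bar>e x ^ m\<bar> \<and>
    \<bar>c x\<bar> < K * \<bar>e x ^ m\<bar> \<and> K * \<bar>e x ^ m\<bar> < \<delta>) F"
proof -
  obtain A where A: "A > 0" "eventually (\<lambda>x. \<bar>a x\<bar> \<le> A * \<bar>e x ^ m\<bar>) F"
    using assms(1) by (auto elim: landau_o.bigE)
  obtain B where B: "B > 0" "eventually (\<lambda>x. \<bar>b x\<bar> \<le> B * \<bar>e x ^ m\<bar>) F"
    using assms(2) by (auto elim: landau_o.bigE)
  obtain D where D: "D > 0" "eventually (\<lambda>x. \<bar>c x\<bar> \<le> D * \<bar>e x ^ m\<bar>) F"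
    using assms(3) by (auto elim: landau_o.bigE)
  define K where "K = A + B + D"
  have "((\<lambda>x. K * \<bar>e x ^ m\<bar>) \<longlongrightarrow> K * \<bar>0 ^ m\<bar>) F" by (intro tendsto_intros e_lim)
  then have lim: "((\<lambda>x. K * \<bar>e x ^ m\<bar>) \<longlongrightarrow> 0) F" using assms(4) by (simp add: zero_power)
  show ?thesis
  proof (rule that[of K])
    show "K > 0" using A B D by (simp add: K_def)
    show "eventually (\<lambda>x. \<bar>a x\<bar> < K * \<bar>e x ^ m\<bar> \<and> \<bar>b x\<bar> < K * \<bar>e x ^ m\<bar> \<and>
      \<bar>c x\<bar> < K * \<bar>e x ^ m\<bar> \<and> K * \<bar>e x ^ m\<bar> < \<delta>) F"
      using A(2) B(2) D(2) e_nz order_tendstoD(2)[OF lim pos(1)]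
    proof eventually_elim
      case (elim x)
      then have "A * \<bar>e x ^ m\<bar> > 0" "B * \<bar>e x ^ m\<bar> > 0" "D * \<bar>e x ^ m\<bar> > 0"
        using A(1) B(1) D(1) by simp_all
      with elim show ?case by (simp add: K_def distrib_right)
    qed
  qed
qed

text \<open>On a ball of radius \<open>K \<bar>e ^ m\<bar>\<close> the cubic bound for
  \<open>r'\<close> yields the exponent \<open>3 * m\<close>, so nodes closer to the root give a
  smaller remainder.\<close>

lemma divdiff_r_bigo:
  assumes "a \<in> O[F](\<lambda>x. e x ^ m)" "b \<in> O[F](\<lambda>x. e x ^ m)" "m > 0"
  shows "(\<lambda>x. divdiff r (a x) (b x)) \<in> O[F](\<lambda>x. e x ^ (3 * m))"
proof -
  obtain K where K: "K > 0" "eventually (\<lambda>x. \<bar>a x\<bar> < K * \<bar>e x ^ m\<bar> \<and> \<bar>b x\<bar> < K * \<bar>e x ^ m\<bar> \<and>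
    \<bar>b x\<bar> < K * \<bar>e x ^ m\<bar> \<and> K * \<bar>e x ^ m\<bar> < \<delta>) F"
    by (rule bigo_radius[OF assms(1,2,2,3)])
  have "eventually (\<lambda>x. norm (divdiff r (a x) (b x)) \<le> C * K ^ 3 * norm (e x ^ (3 * m))) F"
    using K(2)
  proof eventually_elim
    case (elim x)
    have "\<bar>divdiff r (a x) (b x)\<bar> \<le> C * (K * \<bar>e x ^ m\<bar>) ^ 3"
    proof (rule divdiff_bound[of \<delta> r r' "K * \<bar>e x ^ m\<bar>"])
      fix u :: real assume u: "\<bar>u\<bar> < K * \<bar>e x ^ m\<bar>"
      then have "\<bar>r' u\<bar> \<le> C * \<bar>u\<bar> ^ 3" using elim by (intro bound') simp
      also have "\<dots> \<le> C * (K * \<bar>e x ^ m\<bar>) ^ 3"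
        using u pos by (intro mult_left_mono power_mono) simp_all
      finally show "\<bar>r' u\<bar> \<le> C * (K * \<bar>e x ^ m\<bar>) ^ 3" .
    qed (use elim der in simp_all)
    also have "\<dots> = C * K ^ 3 * \<bar>e x ^ (3 * m)\<bar>"
      by (simp add: power_mult_distrib power_abs power_mult mult.commute[of 3])
    finally show ?case by simp
  qed
  then show ?thesis by (rule bigoI)
qed

text \<open>The factor \<open>a - b\<close> is kept rather than estimated by a power of
  \<open>e\<close>. It is divided out when the nodes are \<open>w\<close> and \<open>0\<close>, and
  it contributes a further \<open>e ^ 2\<close> when they are \<open>z\<close> and
  \<open>y\<close>.\<close>

lemma divdiff_r_diff_bigo:
  assumes "a \<in> O[F](\<lambda>x. e x ^ 1)" "b \<in> O[F](\<lambda>x. e x ^ 1)" "c \<in> O[F](\<lambda>x. e x ^ 1)"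
    and ne: "eventually (\<lambda>x. a x \<noteq> c x) F" "eventually (\<lambda>x. b x \<noteq> c x) F"
  shows "(\<lambda>x. divdiff r (a x) (c x) - divdiff r (b x) (c x)) \<in> O[F](\<lambda>x. (a x - b x) * e x ^ 2)"
proof -
  obtain K where K: "K > 0" "eventually (\<lambda>x. \<bar>a x\<bar> < K * \<bar>e x ^ 1\<bar> \<and> \<bar>b x\<bar> < K * \<bar>e x ^ 1\<bar> \<and>
    \<bar>c x\<bar> < K * \<bar>e x ^ 1\<bar> \<and> K * \<bar>e x ^ 1\<bar> < \<delta>) F"
    by (rule bigo_radius[OF assms(1-3)]) simp_all
  have "eventually (\<lambda>x. norm (divdiff r (a x) (c x) - divdiff r (b x) (c x)) \<le> C * K ^ 2 * norm ((a x - b x) * e x ^ 2)) F"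
    using K(2) ne
  proof eventually_elim
    case (elim x)
    have "\<bar>divdiff r (a x) (c x) - divdiff r (b x) (c x)\<bar> \<le> C * (K * \<bar>e x\<bar>) ^ 2 * \<bar>a x - b x\<bar>"
    proof (rule divdiff_diff_bound[of "K * \<bar>e x\<bar>" r r' r''])
      fix u :: real assume u: "\<bar>u\<bar> < K * \<bar>e x\<bar>"
      then have "\<bar>u\<bar> < \<delta>" using elim by simp
      with der der' show "(r has_real_derivative r' u) (at u)" "(r' has_real_derivative r'' u) (at u)" by blast+
      from \<open>\<bar>u\<bar> < \<delta>\<close> have "\<bar>r'' u\<bar> \<le> C * \<bar>u\<bar> ^ 2" by (rule bound'')
      also have "\<dots> \<le> C * (K * \<bar>e x\<bar>) ^ 2"
        using u pos by (intro mult_left_mono power_mono) simp_all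
      finally show "\<bar>r'' u\<bar> \<le> C * (K * \<bar>e x\<bar>) ^ 2" .
    qed (use elim in simp_all)
    also have "\<dots> = C * K ^ 2 * \<bar>(a x - b x) * e x ^ 2\<bar>"
      by (simp add: power_mult_distrib abs_mult power_abs)
    finally show ?case by simp
  qed
  then show ?thesis by (rule bigoI)
qed

text \<open>This is \<open>g u / u\<close> with the value \<open>c1\<close> at \<open>0\<close>, since \<open>divdiff r 0 0 = 0 / 0 = 0\<close>.\<close>
definition gq :: "real \<Rightarrow> real" where
  "gq u = c1 + c2 * u + c3 * u ^ 2 + divdiff r u 0"

lemma g_gq: "g u = u * gq u"
  by (cases "u = 0") (auto simp: g_eq gq_def divdiff_def r_0 algebra_simps power2_eq_square power3_eq_cube)

text \<open>The divided differences of monomials are the complete homogeneous symmetric polynomials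
  of the nodes.\<close>

lemma divdiff_g:
  "a \<noteq> b \<Longrightarrow> divdiff g a b = c1 + c2 * (a + b) + c3 * (a ^ 2 + a * b + b ^ 2) + divdiff r a b"
  unfolding divdiff_def g_eq by (simp add: divide_simps) (simp add: algebra_simps power2_eq_square power3_eq_cube)

lemma gq_bigo:
  assumes "a \<in> O[F](\<lambda>x. e x ^ m)" "m > 0"
  shows "(\<lambda>x. gq (a x) - c1) \<in> O[F](\<lambda>x. e x ^ m)"
proof -
  have "(\<lambda>x. divdiff r (a x) 0) \<in> O[F](\<lambda>x. e x ^ m)"
    by (rule bigo_power_trans[OF divdiff_r_bigo]) (use assms in auto)
  moreover have "(\<lambda>x. a x ^ 2) \<in> O[F](\<lambda>x. e x ^ m)"
    using bigo_power_trans[OF bigo_power_mult[OF assms(1,1)], of m] by (simp add: power2_eq_square)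
  ultimately have "(\<lambda>x. c2 * a x + c3 * a x ^ 2 + divdiff r (a x) 0) \<in> O[F](\<lambda>x. e x ^ m)"
    using assms by (intro sum_in_bigo) simp_all
  then show ?thesis by (simp add: gq_def add.assoc)
qed

lemma gq_lim:
  assumes "a \<in> O[F](\<lambda>x. e x ^ m)" "m > 0"
  shows "((\<lambda>x. gq (a x)) \<longlongrightarrow> c1) F"
  using bigo_power_lim[OF gq_bigo[OF assms] assms(2)] by (simp add: LIM_zero_cancel)

text \<open>The remainder \<open>divdiff r (a x) 0\<close> is only bounded by \<open>e ^ 3\<close>,
  which limits the expansion to order three.\<close>

lemma jet_gq:
  assumes "a \<in> O[F](\<lambda>x. e x ^ 1)" "jet 3 a"
  shows "jet 3 (\<lambda>x. gq (a x))"
  using jet_bigo[OF divdiff_r_bigo[of a 1 "\<lambda>_. 0"]] assms unfolding gq_def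
  by (intro jet_add jet_mult jet_const jet_power) (simp_all del: jet.simps)

lemma divdiff_g_bigo:
  assumes "a \<in> O[F](\<lambda>x. e x ^ 1)" "b \<in> O[F](\<lambda>x. e x ^ 1)" "eventually (\<lambda>x. a x \<noteq> b x) F"
  shows "(\<lambda>x. divdiff g (a x) (b x) - c1 - c2 * (a x + b x)) \<in> O[F](\<lambda>x. e x ^ 2)"
proof -
  have "(\<lambda>x. divdiff r (a x) (b x)) \<in> O[F](\<lambda>x. e x ^ 2)"
    by (rule bigo_power_trans[OF divdiff_r_bigo[of _ 1]]) (use assms in auto)
  moreover have "(\<lambda>x. c3 * (a x * a x + a x * b x + b x * b x)) \<in> O[F](\<lambda>x. e x ^ 2)"
    using bigo_power_mult[OF assms(1,1)] bigo_power_mult[OF assms(1,2)] bigo_power_mult[OF assms(2,2)]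
    by (simp add: sum_in_bigo numeral_2_eq_2)
  ultimately have "(\<lambda>x. c3 * (a x * a x + a x * b x + b x * b x) + divdiff r (a x) (b x)) \<in> O[F](\<lambda>x. e x ^ 2)"
    by (intro sum_in_bigo)
  moreover have "eventually (\<lambda>x. c3 * (a x * a x + a x * b x + b x * b x) + divdiff r (a x) (b x) =
      divdiff g (a x) (b x) - c1 - c2 * (a x + b x)) F"
    using assms(3) by eventually_elim (simp add: divdiff_g power2_eq_square)
  ultimately show ?thesis using landau_o.big.in_cong[of _ _ F] by fastforce
qed

lemma divdiff_g_lim:
  assumes "a \<in> O[F](\<lambda>x. e x ^ 1)" "b \<in> O[F](\<lambda>x. e x ^ 1)" "eventually (\<lambda>x. a x \<noteq> b x) F"
  shows "((\<lambda>x. divdiff g (a x) (b x)) \<longlongrightarrow> c1) F"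
proof -
  have "((\<lambda>x. (divdiff g (a x) (b x) - c1 - c2 * (a x + b x)) + (c1 + c2 * (a x + b x)))
      \<longlongrightarrow> 0 + (c1 + c2 * (0 + 0))) F"
    by (intro tendsto_intros bigo_power_lim[OF divdiff_g_bigo] bigo_power_lim[of _ 1] assms) simp_all
  then show ?thesis by simp
qed

lemma jet_divdiff_g:
  assumes "a \<in> O[F](\<lambda>x. e x ^ 1)" "b \<in> O[F](\<lambda>x. e x ^ 1)" "eventually (\<lambda>x. a x \<noteq> b x) F"
    "jet 3 a" "jet 3 b"
  shows "jet 3 (\<lambda>x. divdiff g (a x) (b x))"
proof (rule jet_cong)
  show "eventually (\<lambda>x. c1 + c2 * (a x + b x) + c3 * (a x ^ 2 + a x * b x + b x ^ 2) + divdiff r (a x) (b x) =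
      divdiff g (a x) (b x)) F"
    using assms(3) by eventually_elim (simp add: divdiff_g)
  show "jet 3 (\<lambda>x. c1 + c2 * (a x + b x) + c3 * (a x ^ 2 + a x * b x + b x ^ 2) + divdiff r (a x) (b x))"
    using jet_bigo[OF divdiff_r_bigo[of a 1 b]] assms
    by (intro jet_add jet_mult jet_const jet_power) (simp_all del: jet.simps)
qed

end

text \<open>
  All points are measured relative to the root: \<open>g u = f (\<alpha> + u)\<close>, and \<open>e\<close>, \<open>w\<close>, \<open>y\<close>, \<open>z\<close> are the
  errors of the current iterate and of the three substeps.
\<close>
locale scheme_step = cubic_root F e g r r' r'' c1 c2 c3 C \<delta>
  for F :: "'a filter" and e :: "'a \<Rightarrow> real" and g r r' r'' :: "real \<Rightarrow> real"
    and c1 c2 c3 C \<delta> :: real +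
  fixes \<kappa> g1 g2 h a1 a2 a3 a4 a5 a6 a7 a8 :: real
    and G0 G1 :: "real \<Rightarrow> real"
    and G2 :: "real \<Rightarrow> real \<Rightarrow> real"
    and H :: "real \<Rightarrow> real \<Rightarrow> real \<Rightarrow> real"
    and w y z :: "'a \<Rightarrow> real"
  assumes \<kappa>: "\<kappa> \<noteq> 0"
    and G0: "(\<lambda>t1. G0 t1 - (1 + t1 + a1 * t1\<^sup>2)) \<in> O[nhds 0](\<lambda>t1. t1 ^ 3)"
    and G1: "(\<lambda>t2. G1 t2 - (1 + t2 + a2 * t2\<^sup>2)) \<in> O[nhds 0](\<lambda>t2. t2 ^ 3)"
    and G2: "(\<lambda>(t1, t2). G2 t1 t2 - (1 + t1 + t2 + a3 * t1\<^sup>2 + a4 * t2\<^sup>2 + a5 * t1 * t2))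
           \<in> O[nhds (0, 0)](\<lambda>t. norm t ^ 3)"
    and H: "(\<lambda>(t3, t4, t5). H t3 t4 t5 - (1 + a6 * t3 + a7 * t4 + a8 * t5))
           \<in> O[nhds (0, 0, 0)](\<lambda>t. norm t ^ 2)"
    and w_eq: "eventually (\<lambda>x. w x = e x - \<kappa> * g (e x)) F"
    and y_eq: "eventually (\<lambda>x. y x = e x - g (e x) / divdiff g (e x) (w x)) F"
    and z_eq: "eventually (\<lambda>x. z x = y x - ((1 - g1 - g2) / divdiff g (y x) (w x) * G0 (g (y x) / g (e x))
           + g1 / divdiff g (e x) (y x) * G1 (g (y x) / g (w x))
           + g2 / divdiff g (e x) (w x) * G2 (g (y x) / g (e x)) (g (y x) / g (w x))) * g (y x)) F"
    and distinct: "eventually (\<lambda>x. e x \<noteq> w x) F" "eventually (\<lambda>x. y x \<noteq> w x) F"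
      "eventually (\<lambda>x. e x \<noteq> y x) F" "eventually (\<lambda>x. z x \<noteq> y x) F"
      "eventually (\<lambda>x. z x \<noteq> w x) F" "eventually (\<lambda>x. z x \<noteq> e x) F"
    and nonzero: "eventually (\<lambda>x. g (w x) \<noteq> 0) F" "eventually (\<lambda>x. g (y x) \<noteq> 0) F"
begin

lemma w_nz: "eventually (\<lambda>x. w x \<noteq> 0) F"
  using nonzero(1) by eventually_elim (auto simp: g_gq)

lemma y_nz: "eventually (\<lambda>x. y x \<noteq> 0) F"
  using nonzero(2) by eventually_elim (auto simp: g_gq)

lemma e_bigo: "e \<in> O[F](\<lambda>x. e x ^ 1)"
  by simp

subsection \<open>The Newton-type substep\<close>

text \<open>The factor in \<open>w = e \<mu>\<close>. Its limit \<open>1 - \<kappa> c1\<close> may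
  be \<open>0\<close>; then \<open>w\<close> is of smaller order than \<open>e\<close>, and
  quotients by \<open>w\<close> cannot be estimated through powers of \<open>e\<close>.\<close>

definition \<mu> :: "'a \<Rightarrow> real" where
  "\<mu> x = 1 - \<kappa> * gq (e x)"

lemma jet_\<mu>: "jet 3 \<mu>"
  unfolding \<mu>_def[abs_def] by (intro jet_diff jet_mult jet_const jet_gq e_bigo jet_e)

lemma \<mu>_bounded: "\<mu> \<in> O[F](\<lambda>_. 1)"
  by (rule jet_bounded[OF jet_\<mu>])

lemma w_\<mu>: "eventually (\<lambda>x. w x = e x * \<mu> x) F"
  using w_eq by eventually_elim (simp add: \<mu>_def g_gq algebra_simps)

lemma w_bigo: "w \<in> O[F](\<lambda>x. e x ^ 1)"
  using bigo_of_e_mult[OF \<mu>_bounded, of 1] landau_o.big.in_cong[OF w_\<mu>] by simp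

lemma jet_w: "jet 4 w"
proof -
  have "eventually (\<lambda>x. e x * \<mu> x = w x) F" using w_\<mu> by eventually_elim simp
  from jet_cong[OF this jet_e_mult[OF jet_\<mu>]] show ?thesis by (simp del: jet.simps)
qed

text \<open>
  By Newton interpolation, \<open>\<rho>\<close> is the quotient of \<open>g[e, w, 0]\<close> by \<open>g[e, w]\<close>.
\<close>
definition \<rho> :: "'a \<Rightarrow> real" where
  "\<rho> x = (divdiff g (e x) (w x) - gq (e x)) / w x / divdiff g (e x) (w x)"

text \<open>Since \<open>gq (e x)\<close> is \<open>g[e, 0]\<close>, the numerator is a difference
  of divided differences with the common node \<open>e\<close>. Its remainder part is of order
  \<open>w e^2\<close>, so dividing by \<open>w\<close> is harmless however small \<open>w\<close>
  is.\<close>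

lemma \<rho>_numerator:
  "(\<lambda>x. (divdiff g (e x) (w x) - gq (e x)) / w x - (c2 + c3 * (e x + w x))) \<in> O[F](\<lambda>x. e x ^ 2)"
proof -
  have "(\<lambda>x. divdiff r (w x) (e x) - divdiff r 0 (e x)) \<in> O[F](\<lambda>x. (w x - 0) * e x ^ 2)"
  proof (intro divdiff_r_diff_bigo w_bigo e_bigo)
    show "eventually (\<lambda>x. w x \<noteq> e x) F" using distinct(1) by eventually_elim simp
    show "eventually (\<lambda>x. 0 \<noteq> e x) F" using e_nz by eventually_elim simp
  qed simp
  then have "(\<lambda>x. (divdiff r (w x) (e x) - divdiff r 0 (e x)) / w x) \<in> O[F](\<lambda>x. (w x - 0) * e x ^ 2 / w x)"
    using w_nz by (intro landau_o.big.divide_right)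
  also have "(\<lambda>x. (w x - 0) * e x ^ 2 / w x) \<in> O[F](\<lambda>x. e x ^ 2)"
    by (rule bigoI[of _ 1]) (use w_nz in \<open>auto elim: eventually_mono\<close>)
  finally have *: "(\<lambda>x. (divdiff r (w x) (e x) - divdiff r 0 (e x)) / w x) \<in> O[F](\<lambda>x. e x ^ 2)" .
  have "eventually (\<lambda>x. (divdiff r (w x) (e x) - divdiff r 0 (e x)) / w x =
    (divdiff g (e x) (w x) - gq (e x)) / w x - (c2 + c3 * (e x + w x))) F"
    using distinct(1) w_nz
  proof eventually_elim
    case (elim x)
    have "divdiff g (e x) (w x) - gq (e x) =
      w x * (c2 + c3 * (e x + w x)) + (divdiff r (w x) (e x) - divdiff r 0 (e x))"
      using elim by (simp add: divdiff_g gq_def divdiff_commute[of r "w x"] divdiff_commute[of r 0]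
        algebra_simps power2_eq_square)
    then show ?case using elim by (simp add: field_simps)
  qed
  from landau_o.big.in_cong[OF this] * show ?thesis by simp
qed

lemma q_ew: "jet 3 (\<lambda>x. divdiff g (e x) (w x))" "((\<lambda>x. divdiff g (e x) (w x)) \<longlongrightarrow> c1) F"
  using jet_mono[OF jet_w, of 3]
  by (auto intro!: jet_divdiff_g divdiff_g_lim e_bigo w_bigo distinct(1) jet_e simp del: jet.simps)

lemma jet_\<rho>: "jet 2 \<rho>"
proof -
  have "jet 2 (\<lambda>x. ((divdiff g (e x) (w x) - gq (e x)) / w x - (c2 + c3 * (e x + w x))) + (c2 + c3 * (e x + w x)))"
    by (intro jet_add jet_mult jet_const jet_e jet_mono[OF jet_w] jet_bigo[OF \<rho>_numerator]) simp
  then have "jet 2 (\<lambda>x. (divdiff g (e x) (w x) - gq (e x)) / w x)" by (simp del: jet.simps)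
  then show ?thesis unfolding \<rho>_def[abs_def]
    by (rule jet_divide[OF _ jet_mono[OF q_ew(1)] q_ew(2) c1]) simp
qed

lemma \<rho>_lim: "(\<rho> \<longlongrightarrow> c2 / c1) F"
proof -
  have "((\<lambda>x. ((divdiff g (e x) (w x) - gq (e x)) / w x - (c2 + c3 * (e x + w x))) + (c2 + c3 * (e x + w x)))
      \<longlongrightarrow> 0 + (c2 + c3 * (0 + 0))) F"
    by (intro tendsto_intros bigo_power_lim[OF \<rho>_numerator] bigo_power_lim[OF w_bigo] e_lim) simp_all
  then have "((\<lambda>x. (divdiff g (e x) (w x) - gq (e x)) / w x) \<longlongrightarrow> c2) F" by simp
  then show ?thesis unfolding \<rho>_def[abs_def] by (intro tendsto_intros q_ew c1)
qed

text \<open>With \<open>g (e x) = e gq (e x)\<close> the substep reads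
  \<open>y = e (1 - gq (e x) / g[e, w])\<close>, and the bracket is \<open>w \<rho>\<close>.\<close>

lemma y_\<rho>: "eventually (\<lambda>x. y x = e x * w x * \<rho> x) F"
  using y_eq w_nz tendsto_imp_eventually_ne[OF q_ew(2) c1]
proof eventually_elim
  case (elim x)
  then have "e x * w x * \<rho> x = e x * ((divdiff g (e x) (w x) - gq (e x)) / divdiff g (e x) (w x))"
    by (simp add: \<rho>_def)
  also have "\<dots> = y x" using elim by (simp add: g_gq diff_divide_distrib algebra_simps)
  finally show ?case ..
qed

lemma y_\<mu>\<rho>: "eventually (\<lambda>x. y x = e x ^ 2 * (\<mu> x * \<rho> x)) F"
  using y_\<rho> w_\<mu> by eventually_elim (simp add: power2_eq_square)

lemma jet_\<mu>\<rho>: "jet 2 (\<lambda>x. \<mu> x * \<rho> x)"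
  by (intro jet_mult jet_\<rho> jet_mono[OF jet_\<mu>]) simp

lemma y_bigo: "y \<in> O[F](\<lambda>x. e x ^ 2)"
  using bigo_of_e_mult[OF jet_bounded[OF jet_\<mu>\<rho>], of 2] landau_o.big.in_cong[OF y_\<mu>\<rho>] by simp

lemma y_bigo_1: "y \<in> O[F](\<lambda>x. e x ^ 1)"
  by (rule bigo_power_trans[OF y_bigo]) simp

lemma jet_y: "jet 4 y"
proof -
  have "eventually (\<lambda>x. e x ^ 2 * (\<mu> x * \<rho> x) = y x) F" using y_\<mu>\<rho> by eventually_elim simp
  from jet_cong[OF this jet_e_power_mult[OF jet_\<mu>\<rho>, of 2]] show ?thesis by (simp del: jet.simps)
qed

subsection \<open>The third substep\<close>

definition t1 :: "'a \<Rightarrow> real" where "t1 x = g (y x) / g (e x)"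
definition t2 :: "'a \<Rightarrow> real" where "t2 x = g (y x) / g (w x)"

lemma gq_lims:
  "((\<lambda>x. gq (e x)) \<longlongrightarrow> c1) F" "((\<lambda>x. gq (w x)) \<longlongrightarrow> c1) F" "((\<lambda>x. gq (y x)) \<longlongrightarrow> c1) F"
  by (rule gq_lim[OF e_bigo] gq_lim[OF w_bigo] gq_lim[OF y_bigo], simp)+

lemma jet_gqs: "jet 3 (\<lambda>x. gq (e x))" "jet 3 (\<lambda>x. gq (w x))" "jet 3 (\<lambda>x. gq (y x))"
  by (intro jet_gq e_bigo w_bigo y_bigo_1 jet_e jet_mono[OF jet_w] jet_mono[OF jet_y]; simp)+

text \<open>In \<open>y = e w \<rho>\<close>, division by \<open>e\<close> leaves \<open>w\<close>,
  and division by \<open>w\<close>, as in \<open>t2\<close>, leaves \<open>e\<close>. Both quotients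
  are exact, even when \<open>w\<close> is much smaller than \<open>e\<close>.\<close>

lemma t1_eq: "eventually (\<lambda>x. t1 x = w x * (\<rho> x * gq (y x) / gq (e x))) F"
  using y_\<rho> e_nz by eventually_elim (simp add: t1_def g_gq)

lemma t2_eq: "eventually (\<lambda>x. t2 x = e x * (\<rho> x * gq (y x) / gq (w x))) F"
  using y_\<rho> w_nz by eventually_elim (simp add: t2_def g_gq)

lemma ratio:
  assumes "jet 3 d" "(d \<longlongrightarrow> c1) F"
  shows "jet 2 (\<lambda>x. \<rho> x * gq (y x) / d x)" "((\<lambda>x. \<rho> x * gq (y x) / d x) \<longlongrightarrow> c2 / c1) F"
    "(\<lambda>x. \<rho> x * gq (y x) / d x - c2 / c1) \<in> O[F](\<lambda>x. e x ^ 1)"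
proof -
  show 1: "jet 2 (\<lambda>x. \<rho> x * gq (y x) / d x)"
    by (intro jet_divide[OF _ _ assms(2) c1] jet_mult jet_\<rho> jet_mono[OF jet_gqs(3)] jet_mono[OF assms(1)]) simp_all
  have "((\<lambda>x. \<rho> x * gq (y x) / d x) \<longlongrightarrow> c2 / c1 * c1 / c1) F"
    by (intro tendsto_intros \<rho>_lim gq_lims assms c1)
  then show 2: "((\<lambda>x. \<rho> x * gq (y x) / d x) \<longlongrightarrow> c2 / c1) F" using c1 by simp
  show "(\<lambda>x. \<rho> x * gq (y x) / d x - c2 / c1) \<in> O[F](\<lambda>x. e x ^ 1)"
    by (rule jet_limit[OF _ 2, of 1]) (use 1 in \<open>simp add: numeral_2_eq_2 del: jet.simps\<close>)
qed

text \<open>The leading terms \<open>(c2 / c1) w\<close> of \<open>t1\<close> and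
  \<open>(c2 / c1) e\<close> of \<open>t2\<close> are the relative linear terms of the divided
  differences in the third substep.\<close>

lemma jet_t1: "jet 3 t1" and t1_bigo: "t1 \<in> O[F](\<lambda>x. e x ^ 1)"
  and t1_lead: "(\<lambda>x. t1 x - c2 / c1 * w x) \<in> O[F](\<lambda>x. e x ^ 2)"
proof -
  note R = ratio[OF jet_gqs(1) gq_lims(1)]
  have ev: "eventually (\<lambda>x. e x * (\<mu> x * (\<rho> x * gq (y x) / gq (e x))) = t1 x) F"
    using t1_eq w_\<mu> by eventually_elim simp
  have "jet (Suc 2) (\<lambda>x. e x * (\<mu> x * (\<rho> x * gq (y x) / gq (e x))))"
    by (intro jet_e_mult jet_mult R jet_mono[OF jet_\<mu>]) simp
  from jet_cong[OF ev this] show "jet 3 t1" by (simp del: jet.simps)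
  show "t1 \<in> O[F](\<lambda>x. e x ^ 1)"
    using bigo_mult_1[OF w_bigo bigo_lim[OF R(2)]] landau_o.big.in_cong[OF t1_eq] by simp
  have ev: "eventually (\<lambda>x. t1 x - c2 / c1 * w x = w x * (\<rho> x * gq (y x) / gq (e x) - c2 / c1)) F"
    using t1_eq by eventually_elim (simp add: algebra_simps)
  show "(\<lambda>x. t1 x - c2 / c1 * w x) \<in> O[F](\<lambda>x. e x ^ 2)"
    using bigo_power_mult[OF w_bigo R(3)] landau_o.big.in_cong[OF ev] by (simp add: numeral_2_eq_2)
qed

lemma jet_t2: "jet 3 t2" and t2_bigo: "t2 \<in> O[F](\<lambda>x. e x ^ 1)"
  and t2_lead: "(\<lambda>x. t2 x - c2 / c1 * e x) \<in> O[F](\<lambda>x. e x ^ 2)"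
proof -
  note R = ratio[OF jet_gqs(2) gq_lims(2)]
  have ev: "eventually (\<lambda>x. e x * (\<rho> x * gq (y x) / gq (w x)) = t2 x) F"
    using t2_eq by eventually_elim simp
  have "jet (Suc 2) (\<lambda>x. e x * (\<rho> x * gq (y x) / gq (w x)))"
    by (intro jet_e_mult R)
  from jet_cong[OF ev this] show "jet 3 t2" by (simp del: jet.simps)
  show "t2 \<in> O[F](\<lambda>x. e x ^ 1)"
    using bigo_mult_1[OF e_bigo bigo_lim[OF R(2)]] landau_o.big.in_cong[OF t2_eq] by simp
  have ev: "eventually (\<lambda>x. t2 x - c2 / c1 * e x = e x * (\<rho> x * gq (y x) / gq (w x) - c2 / c1)) F"
    using t2_eq by eventually_elim (simp add: algebra_simps)
  show "(\<lambda>x. t2 x - c2 / c1 * e x) \<in> O[F](\<lambda>x. e x ^ 2)"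
    using bigo_power_mult[OF e_bigo R(3)] landau_o.big.in_cong[OF ev] by (simp add: numeral_2_eq_2)
qed

section \<open>Expansions of the weights \<open>G0\<close>, \<open>G1\<close> and
  \<open>G2\<close>\<close>

text \<open>Common to the three weights: \<open>s\<close> is the linear and \<open>p\<close> the
  quadratic part. The expansion to order three keeps both, while the cancellation only sees
  \<open>s\<close>.\<close>

lemma weight_expansion:
  assumes R: "(\<lambda>x. G x - (1 + s x + p x)) \<in> O[F](\<lambda>x. e x ^ 3)"
    and s: "jet 3 s" "s \<in> O[F](\<lambda>x. e x ^ 1)" and p: "jet 3 p" "p \<in> O[F](\<lambda>x. e x ^ 2)"
  shows "jet 3 G" "(G \<longlongrightarrow> 1) F" "(\<lambda>x. G x - 1 - s x) \<in> O[F](\<lambda>x. e x ^ 2)"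
proof -
  have "jet 3 (\<lambda>x. (G x - (1 + s x + p x)) + (1 + s x + p x))"
    by (intro jet_add jet_const s p jet_bigo[OF R])
  then show "jet 3 G" by (simp del: jet.simps)
  have "(\<lambda>x. (G x - (1 + s x + p x)) + p x) \<in> O[F](\<lambda>x. e x ^ 2)"
    by (intro sum_in_bigo p bigo_power_trans[OF R]) simp
  then show 1: "(\<lambda>x. G x - 1 - s x) \<in> O[F](\<lambda>x. e x ^ 2)" by (simp add: algebra_simps)
  have "((\<lambda>x. (G x - 1 - s x) + (1 + s x)) \<longlongrightarrow> 0 + (1 + 0)) F"
    by (intro tendsto_intros bigo_power_lim[OF 1] bigo_power_lim[OF s(2)]) simp_all
  then show "(G \<longlongrightarrow> 1) F" by simp
qed

lemma G0_expansion: "jet 3 (\<lambda>x. G0 (t1 x))" "((\<lambda>x. G0 (t1 x)) \<longlongrightarrow> 1) F"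
    "(\<lambda>x. G0 (t1 x) - 1 - t1 x) \<in> O[F](\<lambda>x. e x ^ 2)"
proof -
  have "(\<lambda>x. G0 (t1 x) - (1 + t1 x + a1 * t1 x ^ 2)) \<in> O[F](\<lambda>x. t1 x ^ 3)"
    using landau_o.big.compose[OF G0 bigo_power_lim[OF t1_bigo]] by simp
  also have "(\<lambda>x. t1 x ^ 3) \<in> O[F](\<lambda>x. e x ^ 3)" using bigo_power_of[OF t1_bigo, of 3] by simp
  finally have "(\<lambda>x. G0 (t1 x) - (1 + t1 x + a1 * t1 x ^ 2)) \<in> O[F](\<lambda>x. e x ^ 3)" .
  note * = weight_expansion[OF this jet_t1 t1_bigo]
  have "jet 3 (\<lambda>x. a1 * t1 x ^ 2)" "(\<lambda>x. a1 * t1 x ^ 2) \<in> O[F](\<lambda>x. e x ^ 2)"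
    using bigo_power_of[OF t1_bigo, of 2] by (auto intro!: jet_mult jet_const jet_power jet_t1 simp del: jet.simps)
  from *[OF this] show "jet 3 (\<lambda>x. G0 (t1 x))" "((\<lambda>x. G0 (t1 x)) \<longlongrightarrow> 1) F"
    "(\<lambda>x. G0 (t1 x) - 1 - t1 x) \<in> O[F](\<lambda>x. e x ^ 2)" .
qed

lemma G1_expansion: "jet 3 (\<lambda>x. G1 (t2 x))" "((\<lambda>x. G1 (t2 x)) \<longlongrightarrow> 1) F"
    "(\<lambda>x. G1 (t2 x) - 1 - t2 x) \<in> O[F](\<lambda>x. e x ^ 2)"
proof -
  have "(\<lambda>x. G1 (t2 x) - (1 + t2 x + a2 * t2 x ^ 2)) \<in> O[F](\<lambda>x. t2 x ^ 3)"
    using landau_o.big.compose[OF G1 bigo_power_lim[OF t2_bigo]] by simp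
  also have "(\<lambda>x. t2 x ^ 3) \<in> O[F](\<lambda>x. e x ^ 3)" using bigo_power_of[OF t2_bigo, of 3] by simp
  finally have "(\<lambda>x. G1 (t2 x) - (1 + t2 x + a2 * t2 x ^ 2)) \<in> O[F](\<lambda>x. e x ^ 3)" .
  note * = weight_expansion[OF this jet_t2 t2_bigo]
  have "jet 3 (\<lambda>x. a2 * t2 x ^ 2)" "(\<lambda>x. a2 * t2 x ^ 2) \<in> O[F](\<lambda>x. e x ^ 2)"
    using bigo_power_of[OF t2_bigo, of 2] by (auto intro!: jet_mult jet_const jet_power jet_t2 simp del: jet.simps)
  from *[OF this] show "jet 3 (\<lambda>x. G1 (t2 x))" "((\<lambda>x. G1 (t2 x)) \<longlongrightarrow> 1) F"
    "(\<lambda>x. G1 (t2 x) - 1 - t2 x) \<in> O[F](\<lambda>x. e x ^ 2)" .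
qed

lemma G2_expansion: "jet 3 (\<lambda>x. G2 (t1 x) (t2 x))" "((\<lambda>x. G2 (t1 x) (t2 x)) \<longlongrightarrow> 1) F"
    "(\<lambda>x. G2 (t1 x) (t2 x) - 1 - (t1 x + t2 x)) \<in> O[F](\<lambda>x. e x ^ 2)"
proof -
  have "((\<lambda>x. (t1 x, t2 x)) \<longlongrightarrow> (0, 0)) F"
    by (intro tendsto_Pair bigo_power_lim[OF t1_bigo] bigo_power_lim[OF t2_bigo]) simp_all
  from landau_o.big.compose[OF G2 this]
  have "(\<lambda>x. G2 (t1 x) (t2 x) - (1 + t1 x + t2 x + a3 * (t1 x)\<^sup>2 + a4 * (t2 x)\<^sup>2 + a5 * t1 x * t2 x))
    \<in> O[F](\<lambda>x. norm (t1 x, t2 x) ^ 3)" by simp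
  also have "(\<lambda>x. norm (t1 x, t2 x) ^ 3) \<in> O[F](\<lambda>x. e x ^ 3)"
    using bigo_power_of[OF norm_Pair_bigo[of t1 1 t2], of 3] t1_bigo t2_bigo by simp
  finally have "(\<lambda>x. G2 (t1 x) (t2 x) - (1 + (t1 x + t2 x) + (a3 * (t1 x)\<^sup>2 + a4 * (t2 x)\<^sup>2 + a5 * (t1 x * t2 x))))
    \<in> O[F](\<lambda>x. e x ^ 3)" by (simp add: algebra_simps)
  note * = weight_expansion[OF this]
  have "jet 3 (\<lambda>x. t1 x + t2 x)" "(\<lambda>x. t1 x + t2 x) \<in> O[F](\<lambda>x. e x ^ 1)"
    by (intro jet_add jet_t1 jet_t2, intro sum_in_bigo t1_bigo t2_bigo)
  note * = *[OF this]
  have "jet 3 (\<lambda>x. a3 * (t1 x)\<^sup>2 + a4 * (t2 x)\<^sup>2 + a5 * (t1 x * t2 x))"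
    by (intro jet_add jet_mult jet_const jet_power jet_t1 jet_t2)
  moreover have "(\<lambda>x. a3 * (t1 x)\<^sup>2 + a4 * (t2 x)\<^sup>2 + a5 * (t1 x * t2 x)) \<in> O[F](\<lambda>x. e x ^ 2)"
    using bigo_power_of[OF t1_bigo, of 2] bigo_power_of[OF t2_bigo, of 2] bigo_power_mult[OF t1_bigo t2_bigo]
    by (intro sum_in_bigo) (simp_all add: numeral_2_eq_2)
  ultimately show "jet 3 (\<lambda>x. G2 (t1 x) (t2 x))" "((\<lambda>x. G2 (t1 x) (t2 x)) \<longlongrightarrow> 1) F"
    "(\<lambda>x. G2 (t1 x) (t2 x) - 1 - (t1 x + t2 x)) \<in> O[F](\<lambda>x. e x ^ 2)" using * by blast+
qed

text \<open>The factor in \<open>z = y \<sigma>\<close>. The three coefficients add up to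
  \<open>1\<close>, so the leading \<open>y\<close> of the substep is distributed over three
  brackets of the form treated in \<open>corrector\<close>.\<close>

definition \<sigma> :: "'a \<Rightarrow> real" where
  "\<sigma> x = (1 - g1 - g2) * (1 - gq (y x) / divdiff g (y x) (w x) * G0 (t1 x))
    + g1 * (1 - gq (y x) / divdiff g (e x) (y x) * G1 (t2 x))
    + g2 * (1 - gq (y x) / divdiff g (e x) (w x) * G2 (t1 x) (t2 x))"

lemma z_\<sigma>: "eventually (\<lambda>x. z x = y x * \<sigma> x) F"
  using z_eq
  by eventually_elim (simp add: \<sigma>_def t1_def t2_def g_gq[of "y _"] algebra_simps)

lemma q_yw: "jet 3 (\<lambda>x. divdiff g (y x) (w x))" "((\<lambda>x. divdiff g (y x) (w x)) \<longlongrightarrow> c1) F"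
  using jet_mono[OF jet_w, of 3] jet_mono[OF jet_y, of 3]
  by (auto intro!: jet_divdiff_g divdiff_g_lim y_bigo_1 w_bigo distinct simp del: jet.simps)

lemma q_ey: "jet 3 (\<lambda>x. divdiff g (e x) (y x))" "((\<lambda>x. divdiff g (e x) (y x)) \<longlongrightarrow> c1) F"
  using jet_mono[OF jet_y, of 3]
  by (auto intro!: jet_divdiff_g divdiff_g_lim y_bigo_1 e_bigo jet_e distinct simp del: jet.simps)

lemma jet_\<sigma>: "jet 3 \<sigma>"
  unfolding \<sigma>_def[abs_def]
  by (intro jet_add jet_mult jet_diff jet_const jet_gqs G0_expansion(1) G1_expansion(1) G2_expansion(1)
    jet_divide[OF jet_gqs(3) q_yw c1] jet_divide[OF jet_gqs(3) q_ey c1] jet_divide[OF jet_gqs(3) q_ew c1])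

text \<open>Each bracket cancels by itself, whatever \<open>g1\<close> and \<open>g2\<close> are:
  \<open>g[y, w]\<close> is matched with \<open>t1\<close>, \<open>g[e, y]\<close> with
  \<open>t2\<close>, and \<open>g[e, w]\<close> with \<open>t1 + t2\<close>.\<close>

lemma \<sigma>_bigo: "\<sigma> \<in> O[F](\<lambda>x. e x ^ 2)"
proof -
  note d = gq_bigo[OF y_bigo]
  \<comment> \<open>Here \<open>u\<close> is the sum of two nodes; \<open>c2 u\<close> is exchanged
    for \<open>c1 s\<close>, which agrees with it up to order \<open>e ^ 2\<close>.\<close>
  have sum: "(\<lambda>x. Q x - c1 - c1 * s x) \<in> O[F](\<lambda>x. e x ^ 2)"
    if "(\<lambda>x. Q x - c1 - c2 * u x) \<in> O[F](\<lambda>x. e x ^ 2)" "(\<lambda>x. s x - c2 / c1 * u x) \<in> O[F](\<lambda>x. e x ^ 2)"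
    for Q s u
  proof -
    have "(\<lambda>x. (Q x - c1 - c2 * u x) - c1 * (s x - c2 / c1 * u x)) \<in> O[F](\<lambda>x. e x ^ 2)"
      using c1 that by (intro sum_in_bigo(2)[OF that(1)]) simp
    then show ?thesis using c1 by (simp add: algebra_simps)
  qed
  \<comment> \<open>As \<open>y\<close> is of order \<open>e ^ 2\<close>, including it in the sum of
    the nodes changes nothing at this order.\<close>
  note y = bigo_cmult[OF y_bigo, of "c2 / c1"]
  note t = sum_in_bigo(2)[OF t1_lead y] sum_in_bigo(2)[OF t2_lead y] sum_in_bigo(1)[OF t1_lead t2_lead]
  have yw: "(\<lambda>x. divdiff g (y x) (w x) - c1 - c1 * t1 x) \<in> O[F](\<lambda>x. e x ^ 2)"
    by (rule sum[OF divdiff_g_bigo[OF y_bigo_1 w_bigo distinct(2)]]) (use t(1) in \<open>simp add: algebra_simps\<close>)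
  have ey: "(\<lambda>x. divdiff g (e x) (y x) - c1 - c1 * t2 x) \<in> O[F](\<lambda>x. e x ^ 2)"
    by (rule sum[OF divdiff_g_bigo[OF e_bigo y_bigo_1 distinct(3)]]) (use t(2) in \<open>simp add: algebra_simps\<close>)
  have ew: "(\<lambda>x. divdiff g (e x) (w x) - c1 - c1 * (t1 x + t2 x)) \<in> O[F](\<lambda>x. e x ^ 2)"
    by (rule sum[OF divdiff_g_bigo[OF e_bigo w_bigo distinct(1)]]) (use t(3) in \<open>simp add: algebra_simps\<close>)
  show ?thesis unfolding \<sigma>_def[abs_def]
    by (intro sum_in_bigo(1) bigo_cmult corrector[OF q_yw(2) c1 yw G0_expansion(2,3) d]
      corrector[OF q_ey(2) c1 ey G1_expansion(2,3) d] corrector[OF q_ew(2) c1 ew G2_expansion(2,3) d]) simp_all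
qed

subsection \<open>The last substep\<close>

definition \<sigma>' :: "'a \<Rightarrow> real" where "\<sigma>' x = \<sigma> x / e x ^ 2"

text \<open>Of the order three known for \<open>\<sigma>\<close>, two are spent on the division; the
  remaining one is just enough to read off a leading coefficient.\<close>

lemma jet_\<sigma>': "jet 1 \<sigma>'"
  unfolding \<sigma>'_def[abs_def] by (rule jet_divide_power[OF _ \<sigma>_bigo]) (use jet_\<sigma> in \<open>simp del: jet.simps\<close>)

definition \<zeta> :: "'a \<Rightarrow> real" where "\<zeta> x = \<mu> x * \<rho> x * \<sigma>' x"

lemma jet_\<zeta>: "jet 1 \<zeta>"
  unfolding \<zeta>_def[abs_def] by (intro jet_mult jet_\<sigma>' jet_mono[OF jet_\<mu>\<rho>]) simp

lemma z_\<zeta>: "eventually (\<lambda>x. z x = e x ^ 4 * \<zeta> x) F"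
  using z_\<sigma> y_\<mu>\<rho> e_nz by eventually_elim (simp add: \<zeta>_def \<sigma>'_def power4_eq_xxxx power2_eq_square)

lemma z_bigo: "z \<in> O[F](\<lambda>x. e x ^ 4)"
  using bigo_of_e_mult[OF jet_bounded[OF jet_\<zeta>], of 4] landau_o.big.in_cong[OF z_\<zeta>] by simp

lemma z_bigo_1: "z \<in> O[F](\<lambda>x. e x ^ 1)" and z_bigo_2: "z \<in> O[F](\<lambda>x. e x ^ 2)"
  by (rule bigo_power_trans[OF z_bigo], simp)+

lemma jet_gq_z: "jet 4 (\<lambda>x. gq (z x))"
proof -
  have "jet 4 (\<lambda>x. (gq (z x) - c1) + c1)"
    by (intro jet_add jet_const jet_bigo gq_bigo[OF z_bigo]) simp
  then show ?thesis by (simp del: jet.simps)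
qed

lemma gq_z_lim: "((\<lambda>x. gq (z x)) \<longlongrightarrow> c1) F"
  by (rule gq_lim[OF z_bigo]) simp

section \<open>The last denominator\<close>

definition den :: "'a \<Rightarrow> real" where
  "den x = last_denom g h (e x) (w x) (y x) (z x)"

text \<open>The linear terms in \<open>y\<close>, \<open>w\<close> and \<open>e\<close> cancel and
  leave \<open>2 * c2 * z x\<close>. Divided differences sharing the node \<open>w\<close> or
  \<open>e\<close> are paired, so that each pair is small together with
  \<open>z - y\<close>.\<close>

lemma den_expansion:
  "eventually (\<lambda>x. den x = c1 + (2 * c2 * z x + c3 * (z x * z x + z x * y x + y x * y x
      + (z x - y x) * (z x + y x + h * e x - (h - 1) * w x)))
    + (divdiff r (z x) (y x) - (h - 1) * (divdiff r (z x) (w x) - divdiff r (y x) (w x))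
      + h * (divdiff r (z x) (e x) - divdiff r (y x) (e x)))) F"
  using distinct
proof eventually_elim
  case (elim x)
  then have "y x \<noteq> e x" by simp
  with elim show ?case
    by (simp add: den_def last_denom_def divdiff_g algebra_simps power2_eq_square)
qed

lemma jet_den: "jet 4 den" and den_bigo: "(\<lambda>x. den x - c1) \<in> O[F](\<lambda>x. e x ^ 3)"
  and den_lim: "(den \<longlongrightarrow> c1) F"
proof -
  define P where "P x = 2 * c2 * z x + c3 * (z x * z x + z x * y x + y x * y x
      + (z x - y x) * (z x + y x + h * e x - (h - 1) * w x))" for x
  define R where "R x = divdiff r (z x) (y x) - (h - 1) * (divdiff r (z x) (w x) - divdiff r (y x) (w x))
      + h * (divdiff r (z x) (e x) - divdiff r (y x) (e x))" for x
  have ev: "eventually (\<lambda>x. c1 + P x + R x = den x) F"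
    using den_expansion by eventually_elim (simp add: P_def R_def)
  have ye: "eventually (\<lambda>x. y x \<noteq> e x) F" using distinct(3) by eventually_elim simp
  have zy: "(\<lambda>x. z x - y x) \<in> O[F](\<lambda>x. e x ^ 2)" by (intro sum_in_bigo z_bigo_2 y_bigo)
  have zy2: "(\<lambda>x. (z x - y x) * e x ^ 2) \<in> O[F](\<lambda>x. e x ^ 4)"
    using bigo_power_mult[OF zy, of "\<lambda>x. e x ^ 2" 2] by simp
  \<comment> \<open>In \<open>r[z, y]\<close> both nodes are of order \<open>e ^ 2\<close>; each
    paired difference has the factor \<open>z - y\<close> of order \<open>e ^ 2\<close> in addition
    to \<open>e ^ 2\<close>.\<close>
  have R: "R \<in> O[F](\<lambda>x. e x ^ 4)" unfolding R_def[abs_def]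
  proof (intro sum_in_bigo(1)[OF sum_in_bigo(2)] bigo_cmult)
    show "(\<lambda>x. divdiff r (z x) (y x)) \<in> O[F](\<lambda>x. e x ^ 4)"
      by (rule bigo_power_trans[OF divdiff_r_bigo[OF z_bigo_2 y_bigo]]) simp_all
    show "(\<lambda>x. divdiff r (z x) (w x) - divdiff r (y x) (w x)) \<in> O[F](\<lambda>x. e x ^ 4)"
      by (rule landau_o.big_trans[OF divdiff_r_diff_bigo zy2]) (intro z_bigo_1 y_bigo_1 w_bigo distinct)+
    show "(\<lambda>x. divdiff r (z x) (e x) - divdiff r (y x) (e x)) \<in> O[F](\<lambda>x. e x ^ 4)"
      by (rule landau_o.big_trans[OF divdiff_r_diff_bigo zy2]) (intro z_bigo_1 y_bigo_1 e_bigo distinct ye)+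
  qed
  have lin: "(\<lambda>x. z x + y x + h * e x - (h - 1) * w x) \<in> O[F](\<lambda>x. e x ^ 1)"
    by (intro sum_in_bigo(2)[OF sum_in_bigo(1)] bigo_cmult sum_in_bigo(1) z_bigo_1 y_bigo_1 e_bigo w_bigo)
  \<comment> \<open>The order three is set by \<open>z - y\<close> times the linear form; the other
    terms are of order at least four.\<close>
  have P: "P \<in> O[F](\<lambda>x. e x ^ 3)" unfolding P_def[abs_def]
    by (intro sum_in_bigo(1) bigo_cmult
        bigo_power_trans[OF z_bigo] bigo_power_trans[OF bigo_power_mult[OF z_bigo_2 z_bigo_2]]
        bigo_power_trans[OF bigo_power_mult[OF z_bigo_2 y_bigo]]
        bigo_power_trans[OF bigo_power_mult[OF y_bigo y_bigo]]
        bigo_power_trans[OF bigo_power_mult[OF zy lin]]) simp_all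
  have "jet 4 (\<lambda>x. c1 + P x + R x)" unfolding P_def
    by (intro jet_add jet_mult jet_diff jet_const jet_bigo[OF z_bigo] jet_y jet_w jet_e jet_bigo[OF R])
  from jet_cong[OF ev this] show "jet 4 den" .
  have "(\<lambda>x. P x + R x) \<in> O[F](\<lambda>x. e x ^ 3)"
    by (intro sum_in_bigo P bigo_power_trans[OF R]) simp
  moreover have "eventually (\<lambda>x. den x - c1 = P x + R x) F" using ev by eventually_elim simp
  from landau_o.big.in_cong[OF this] calculation
  show 1: "(\<lambda>x. den x - c1) \<in> O[F](\<lambda>x. e x ^ 3)" by blast
  show "(den \<longlongrightarrow> c1) F" using bigo_power_lim[OF 1] by (simp add: LIM_zero_cancel)
qed

section \<open>The ratios \<open>t3\<close>, \<open>t4\<close>, \<open>t5\<close> and the weight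
  \<open>H\<close>\<close>

definition t3 :: "'a \<Rightarrow> real" where "t3 x = g (z x) / g (e x)"
definition t4 :: "'a \<Rightarrow> real" where "t4 x = g (z x) / g (w x)"
definition t5 :: "'a \<Rightarrow> real" where "t5 x = g (z x) / g (y x)"

lemma t3: "jet 4 t3" "t3 \<in> O[F](\<lambda>x. e x ^ 3)"
proof -
  have ev: "eventually (\<lambda>x. e x ^ 3 * (\<zeta> x * gq (z x) / gq (e x)) = t3 x) F"
    using z_\<zeta> e_nz by eventually_elim (simp add: t3_def g_gq power4_eq_xxxx power3_eq_cube)
  have 1: "jet 1 (\<lambda>x. \<zeta> x * gq (z x) / gq (e x))"
    by (intro jet_divide[OF _ _ gq_lims(1) c1] jet_mult jet_\<zeta> jet_mono[OF jet_gq_z] jet_mono[OF jet_gqs(1)]) simp_all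
  from jet_cong[OF ev jet_e_power_mult[OF 1]] show "jet 4 t3" by (simp del: jet.simps)
  from bigo_of_e_mult[OF jet_bounded[OF 1], of 3] landau_o.big.in_cong[OF ev]
  show "t3 \<in> O[F](\<lambda>x. e x ^ 3)" by blast
qed

text \<open>In \<open>z = e w \<rho> \<sigma>\<close> the factor \<open>w\<close> cancels exactly,
  which leaves \<open>e ^ 3\<close> times \<open>\<rho> \<sigma>'\<close>; the form
  \<open>z = e ^ 4 \<zeta>\<close> would not show this for small \<open>w\<close>.\<close>

lemma t4: "jet 4 t4" "t4 \<in> O[F](\<lambda>x. e x ^ 3)"
proof -
  have ev: "eventually (\<lambda>x. e x ^ 3 * (\<rho> x * \<sigma>' x * gq (z x) / gq (w x)) = t4 x) F"
    using z_\<sigma> y_\<rho> e_nz w_nz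
    by eventually_elim (simp add: t4_def \<sigma>'_def g_gq power2_eq_square power3_eq_cube)
  have 1: "jet 1 (\<lambda>x. \<rho> x * \<sigma>' x * gq (z x) / gq (w x))"
    by (intro jet_divide[OF _ _ gq_lims(2) c1] jet_mult jet_\<sigma>' jet_mono[OF jet_\<rho>] jet_mono[OF jet_gq_z]
        jet_mono[OF jet_gqs(2)]) simp_all
  from jet_cong[OF ev jet_e_power_mult[OF 1]] show "jet 4 t4" by (simp del: jet.simps)
  from bigo_of_e_mult[OF jet_bounded[OF 1], of 3] landau_o.big.in_cong[OF ev]
  show "t4 \<in> O[F](\<lambda>x. e x ^ 3)" by blast
qed

text \<open>Since \<open>z / y = \<sigma>\<close>, only order two is available. This is the ratio
  that makes the coefficient \<open>a8\<close> decisive.\<close>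

lemma t5: "jet 3 t5" "t5 \<in> O[F](\<lambda>x. e x ^ 2)"
proof -
  have ev: "eventually (\<lambda>x. \<sigma> x * (gq (z x) / gq (y x)) = t5 x) F"
    using z_\<sigma> y_nz by eventually_elim (simp add: t5_def g_gq)
  have "jet 3 (\<lambda>x. \<sigma> x * (gq (z x) / gq (y x)))"
    by (intro jet_mult jet_\<sigma> jet_divide[OF _ _ gq_lims(3) c1] jet_mono[OF jet_gq_z] jet_gqs) simp
  from jet_cong[OF ev this] show "jet 3 t5" .
  have "((\<lambda>x. gq (z x) / gq (y x)) \<longlongrightarrow> c1 / c1) F" by (intro tendsto_intros gq_z_lim gq_lims c1)
  from bigo_mult_1[OF \<sigma>_bigo bigo_lim[OF this]] landau_o.big.in_cong[OF ev]
  show "t5 \<in> O[F](\<lambda>x. e x ^ 2)" by blast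
qed

text \<open>All three ratios are of order \<open>e ^ 2\<close>, so the quadratic error of
  \<open>H\<close> is of order \<open>e ^ 4\<close>.\<close>

lemma H_expansion:
  "(\<lambda>x. H (t3 x) (t4 x) (t5 x) - (1 + a6 * t3 x + a7 * t4 x + a8 * t5 x)) \<in> O[F](\<lambda>x. e x ^ 4)"
proof -
  have t34: "t3 \<in> O[F](\<lambda>x. e x ^ 2)" "t4 \<in> O[F](\<lambda>x. e x ^ 2)"
    by (rule bigo_power_trans[OF t3(2)] bigo_power_trans[OF t4(2)]; simp)+
  have "((\<lambda>x. (t3 x, t4 x, t5 x)) \<longlongrightarrow> (0, 0, 0)) F"
    by (intro tendsto_Pair bigo_power_lim[OF t3(2)] bigo_power_lim[OF t4(2)] bigo_power_lim[OF t5(2)]) simp_all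
  from landau_o.big.compose[OF H this]
  have "(\<lambda>x. H (t3 x) (t4 x) (t5 x) - (1 + a6 * t3 x + a7 * t4 x + a8 * t5 x))
    \<in> O[F](\<lambda>x. norm (t3 x, t4 x, t5 x) ^ 2)" by simp
  also have "(\<lambda>x. norm (t3 x, t4 x, t5 x) ^ 2) \<in> O[F](\<lambda>x. e x ^ (2 * 2))"
    using t34 t5(2) by (intro bigo_power_of norm_Pair_bigo) simp_all
  finally show ?thesis by simp
qed

text \<open>Both claims of the theorem at once: \<open>a8 t5\<close> limits \<open>H - 1\<close> to
  order two, and without it the third-order ratios \<open>t3\<close> and \<open>t4\<close>
  lead.\<close>

lemma H_weight:
  assumes "p = 2 \<or> p = 3 \<and> a8 = 0"
  shows "jet (Suc p) (\<lambda>x. H (t3 x) (t4 x) (t5 x))"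
    "(\<lambda>x. H (t3 x) (t4 x) (t5 x) - 1) \<in> O[F](\<lambda>x. e x ^ p)"
proof -
  have p: "p \<le> 3" using assms by auto
  have a8: "jet (Suc p) (\<lambda>x. a8 * t5 x)" "(\<lambda>x. a8 * t5 x) \<in> O[F](\<lambda>x. e x ^ p)"
    using assms jet_mult[OF jet_const t5(1)] t5(2) jet_0 by (auto simp del: jet.simps simp: eval_nat_numeral)
  have "jet (Suc p) (\<lambda>x. (H (t3 x) (t4 x) (t5 x) - (1 + a6 * t3 x + a7 * t4 x + a8 * t5 x))
      + (1 + a6 * t3 x + a7 * t4 x + a8 * t5 x))"
    using p by (intro jet_add[OF jet_mono[OF jet_bigo[OF H_expansion]]] jet_add[OF _ a8(1)] jet_add jet_mult
      jet_const jet_mono[OF t3(1)] jet_mono[OF t4(1)]) simp_all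
  then show "jet (Suc p) (\<lambda>x. H (t3 x) (t4 x) (t5 x))" by (simp del: jet.simps)
  have "(\<lambda>x. (H (t3 x) (t4 x) (t5 x) - (1 + a6 * t3 x + a7 * t4 x + a8 * t5 x))
      + (a6 * t3 x + a7 * t4 x + a8 * t5 x)) \<in> O[F](\<lambda>x. e x ^ p)"
    using p by (intro sum_in_bigo(1)[OF bigo_power_trans[OF H_expansion]] sum_in_bigo(1)[OF _ a8(2)]
        sum_in_bigo(1) bigo_cmult bigo_power_trans[OF t3(2)] bigo_power_trans[OF t4(2)]) simp_all
  then show "(\<lambda>x. H (t3 x) (t4 x) (t5 x) - 1) \<in> O[F](\<lambda>x. e x ^ p)" by simp
qed

lemma step_error:
  assumes p: "p = 2 \<or> p = 3 \<and> a8 = 0"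
  shows "\<exists>K. (\<lambda>x. z x - H (t3 x) (t4 x) (t5 x) * (g (z x) / den x) - K * e x ^ (4 + p))
    \<in> O[F](\<lambda>x. e x ^ (4 + p + 1))"
proof -
  have p3: "p \<le> 3" "p > 0" using p by auto
  note H = H_weight[OF p]
  have H_lim: "((\<lambda>x. H (t3 x) (t4 x) (t5 x)) \<longlongrightarrow> 1) F"
    using bigo_power_lim[OF H(2) p3(2)] by (simp add: LIM_zero_cancel)
  \<comment> \<open>The last substep multiplies the error \<open>z\<close> by
    \<open>\<tau>\<close>.\<close>
  define \<tau> where "\<tau> x = 1 - gq (z x) / den x * H (t3 x) (t4 x) (t5 x)" for x
  have "\<tau> \<in> O[F](\<lambda>x. e x ^ p)" unfolding \<tau>_def[abs_def]
    \<comment> \<open>No linear part has to cancel here. The bound \<open>p \<le> 3\<close> matches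
      the order three of \<open>den - c1\<close>.\<close>
    by (rule corrector[where s = "\<lambda>_. 0", OF den_lim c1 _ H_lim])
      (use H(2) p3 bigo_power_trans[OF den_bigo] bigo_power_trans[OF gq_bigo[OF z_bigo]] in simp_all)
  moreover have "jet (Suc p) \<tau>" unfolding \<tau>_def[abs_def]
    using p3 by (intro jet_diff jet_mult jet_const H(1) jet_divide[OF _ _ den_lim c1] jet_mono[OF jet_gq_z]
      jet_mono[OF jet_den]) simp_all
  ultimately have "jet 1 (\<lambda>x. \<tau> x / e x ^ p)" by (intro jet_divide_power) (simp_all del: jet.simps)
  \<comment> \<open>The error constant \<open>K\<close> is the constant coefficient of
    \<open>\<zeta> \<tau> / e ^ p\<close>.\<close>
  from jet_mult[OF jet_\<zeta> this]
  obtain K v where K: "jet 0 v" "eventually (\<lambda>x. \<zeta> x * (\<tau> x / e x ^ p) = K + e x * v x) F"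
    unfolding One_nat_def by (rule jet_SucE)
  have ev: "eventually (\<lambda>x. e x ^ (4 + p + 1) * v x =
      z x - H (t3 x) (t4 x) (t5 x) * (g (z x) / den x) - K * e x ^ (4 + p)) F"
    using K(2) z_\<zeta> e_nz
  proof eventually_elim
    case (elim x)
    have "z x - H (t3 x) (t4 x) (t5 x) * (g (z x) / den x) = z x * \<tau> x"
      by (simp add: \<tau>_def g_gq algebra_simps)
    also have "\<dots> = e x ^ (4 + p) * (\<zeta> x * (\<tau> x / e x ^ p))"
      using elim(2,3) by (simp add: power_add)
    also have "\<dots> = e x ^ (4 + p) * (K + e x * v x)" using elim(1) by simp
    also have "\<dots> = e x ^ (4 + p + 1) * v x + K * e x ^ (4 + p)"
      unfolding power_add power_one_right by (simp only: distrib_left distrib_right mult_ac)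
    finally show ?case by simp
  qed
  show ?thesis
    using bigo_of_e_mult[OF jet_bounded[OF K(1)], of "4 + p + 1"] landau_o.big.in_cong[OF ev] by blast
qed

end

subsection \<open>Convergence order\<close>

text \<open>For \<open>p \<ge> 2\<close> the error equation makes \<open>\<Phi>\<close> halve the
  error near the root. The iterates therefore stay in that neighbourhood and the errors decay
  geometrically.\<close>

lemma error_equation_imp_locally_convergent:
  assumes "error_equation \<Phi> A \<alpha> p K" "p \<ge> 2" "\<alpha> \<notin> A"
  shows "locally_convergent \<Phi> A \<alpha>"
proof -
  define F where "F = at \<alpha> within A"
  have lim: "((\<lambda>x. x - \<alpha>) \<longlongrightarrow> 0) F" unfolding F_def by (intro tendsto_eq_intros) auto
  have ne: "eventually (\<lambda>x. x - \<alpha> \<noteq> 0) F"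
    unfolding F_def eventually_at_filter by (rule always_eventually) auto
  obtain C where C: "C > 0"
    "eventually (\<lambda>x. norm ((\<Phi> x - \<alpha>) - K * (x - \<alpha>) ^ p) \<le> C * norm ((x - \<alpha>) ^ (p + 1))) F"
    using assms(1) unfolding error_equation_def F_def by (auto elim: landau_o.bigE)
  have "((\<lambda>x. \<bar>K\<bar> * \<bar>x - \<alpha>\<bar> ^ (p - 1) + C * \<bar>x - \<alpha>\<bar> ^ p) \<longlongrightarrow> \<bar>K\<bar> * \<bar>0\<bar> ^ (p - 1) + C * \<bar>0\<bar> ^ p) F"
    by (intro tendsto_intros lim)
  then have "((\<lambda>x. \<bar>K\<bar> * \<bar>x - \<alpha>\<bar> ^ (p - 1) + C * \<bar>x - \<alpha>\<bar> ^ p) \<longlongrightarrow> 0) F"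
    using assms(2) by (simp add: zero_power)
  then have "eventually (\<lambda>x. \<bar>K\<bar> * \<bar>x - \<alpha>\<bar> ^ (p - 1) + C * \<bar>x - \<alpha>\<bar> ^ p < 1 / 2) F"
    by (rule order_tendstoD) simp
  with C(2) have "eventually (\<lambda>x. \<bar>\<Phi> x - \<alpha>\<bar> \<le> 1 / 2 * \<bar>x - \<alpha>\<bar>) F"
  proof eventually_elim
    case (elim x)
    have p: "\<bar>x - \<alpha>\<bar> ^ p = \<bar>x - \<alpha>\<bar> ^ (p - 1) * \<bar>x - \<alpha>\<bar>"
      using assms(2) by (simp flip: power_Suc2)
    have abs: "\<bar>(x - \<alpha>) ^ (p + 1)\<bar> = \<bar>x - \<alpha>\<bar> ^ p * \<bar>x - \<alpha>\<bar>"
      by (simp only: power_abs flip: power_Suc2) simp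
    have "\<bar>\<Phi> x - \<alpha>\<bar> \<le> \<bar>K * (x - \<alpha>) ^ p\<bar> + C * \<bar>(x - \<alpha>) ^ (p + 1)\<bar>" using elim by simp
    also have "\<dots> = (\<bar>K\<bar> * \<bar>x - \<alpha>\<bar> ^ (p - 1) + C * \<bar>x - \<alpha>\<bar> ^ p) * \<bar>x - \<alpha>\<bar>"
      unfolding abs by (simp only: abs_mult power_abs p distrib_left distrib_right mult_ac)
    also have "\<dots> \<le> 1 / 2 * \<bar>x - \<alpha>\<bar>" using elim by (intro mult_right_mono) simp_all
    finally show ?case .
  qed
  \<comment> \<open>The filter says nothing about \<open>\<alpha>\<close> itself;
    \<open>\<alpha> \<notin> A\<close> excludes that point.\<close>
  then obtain \<delta> where \<delta>: "\<delta> > 0"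
    "\<And>x. x \<in> A \<Longrightarrow> \<bar>x - \<alpha>\<bar> < \<delta> \<Longrightarrow> \<bar>\<Phi> x - \<alpha>\<bar> \<le> 1 / 2 * \<bar>x - \<alpha>\<bar>"
    using \<open>\<alpha> \<notin> A\<close> unfolding F_def eventually_at dist_real_def by metis
  show ?thesis unfolding locally_convergent_def
  proof (intro exI[of _ \<delta>] conjI \<delta>(1) allI impI)
    fix x :: "nat \<Rightarrow> real"
    assume x: "\<bar>x 0 - \<alpha>\<bar> < \<delta> \<and> (\<forall>n. x n \<in> A \<and> x (Suc n) = \<Phi> (x n))"
    have bound: "\<bar>x n - \<alpha>\<bar> \<le> (1 / 2) ^ n * \<bar>x 0 - \<alpha>\<bar>" for n
    proof (induction n)
      case (Suc n)
      note Suc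
      also have "(1 / 2) ^ n * \<bar>x 0 - \<alpha>\<bar> \<le> \<bar>x 0 - \<alpha>\<bar>"
        by (intro mult_left_le_one_le power_le_one) simp_all
      also have "\<dots> < \<delta>" using x by simp
      finally have "\<bar>x n - \<alpha>\<bar> < \<delta>" .
      with x \<delta>(2) have "\<bar>x (Suc n) - \<alpha>\<bar> \<le> 1 / 2 * \<bar>x n - \<alpha>\<bar>" by simp
      also have "\<dots> \<le> 1 / 2 * ((1 / 2) ^ n * \<bar>x 0 - \<alpha>\<bar>)" using Suc by (intro mult_left_mono) simp_all
      finally show ?case by simp
    qed simp
    have "(\<lambda>n. (1 / 2) ^ n * \<bar>x 0 - \<alpha>\<bar>) \<longlonglongrightarrow> 0 * \<bar>x 0 - \<alpha>\<bar>"
      by (intro tendsto_intros LIMSEQ_realpow_zero) simp_all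
    then have "(\<lambda>n. x n - \<alpha>) \<longlonglongrightarrow> 0"
      using Lim_null_comparison[of "\<lambda>n. x n - \<alpha>" "\<lambda>n. (1 / 2) ^ n * \<bar>x 0 - \<alpha>\<bar>"] bound by simp
    then show "x \<longlonglongrightarrow> \<alpha>" by (simp add: LIM_zero_iff)
  qed
qed

lemma scheme_error_equation:
  assumes "open D" "Ck_on 4 f D" "\<alpha> \<in> D" "f \<alpha> = 0" "deriv f \<alpha> \<noteq> 0" "\<kappa> \<noteq> 0"
    and G0: "(\<lambda>t1. G0 t1 - (1 + t1 + a1 * t1\<^sup>2)) \<in> O[nhds 0](\<lambda>t1. t1 ^ 3)"
    and G1: "(\<lambda>t2. G1 t2 - (1 + t2 + a2 * t2\<^sup>2)) \<in> O[nhds 0](\<lambda>t2. t2 ^ 3)"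
    and G2: "(\<lambda>(t1, t2). G2 t1 t2 - (1 + t1 + t2 + a3 * t1\<^sup>2 + a4 * t2\<^sup>2 + a5 * t1 * t2))
           \<in> O[nhds (0, 0)](\<lambda>t. norm t ^ 3)"
    and H: "(\<lambda>(t3, t4, t5). H t3 t4 t5 - (1 + a6 * t3 + a7 * t4 + a8 * t5))
           \<in> O[nhds (0, 0, 0)](\<lambda>t. norm t ^ 2)"
    and p: "p = 2 \<or> p = 3 \<and> a8 = 0"
  shows "\<exists>K. error_equation (scheme f \<kappa> g1 g2 h G0 G1 G2 H)
    (admissible D f \<kappa> g1 g2 h G0 G1 G2) \<alpha> (4 + p) K"
proof -
  let ?\<Phi> = "scheme f \<kappa> g1 g2 h G0 G1 G2 H"
  define A where "A = admissible D f \<kappa> g1 g2 h G0 G1 G2"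
  define F where "F = at \<alpha> within A"
  define g where "g u = f (\<alpha> + u)" for u
  define w y z where "w = w_step f \<kappa>" and "y = y_step f \<kappa>" and "z = z_step f \<kappa> g1 g2 G0 G1 G2"
  show ?thesis
  \<comment> \<open>If \<open>\<alpha>\<close> is not a limit point of \<open>A\<close>, the error
    equation is vacuous for every \<open>K\<close>. This happens for affine \<open>f\<close>, where
    \<open>y\<close> hits the root at once.\<close>
  proof (cases "F = bot")
    case True
    then show ?thesis by (auto simp: error_equation_def F_def A_def intro!: bigoI[of _ 1])
  next
    case False
    show ?thesis
    proof (rule Ck4_cubic_remainder[OF assms(1-4)])
      fix \<delta> C c2 c3 :: real and r r' r'' :: "real \<Rightarrow> real"
      assume r: "\<delta> > 0" "C > 0" "r 0 = 0"
        "\<And>u. f (\<alpha> + u) = deriv f \<alpha> * u + c2 * u ^ 2 + c3 * u ^ 3 + r u"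
        "\<And>u. \<bar>u\<bar> < \<delta> \<Longrightarrow> (r has_real_derivative r' u) (at u)"
        "\<And>u. \<bar>u\<bar> < \<delta> \<Longrightarrow> (r' has_real_derivative r'' u) (at u)"
        "\<And>u. \<bar>u\<bar> < \<delta> \<Longrightarrow> \<bar>r' u\<bar> \<le> C * \<bar>u\<bar> ^ 3"
        "\<And>u. \<bar>u\<bar> < \<delta> \<Longrightarrow> \<bar>r'' u\<bar> \<le> C * \<bar>u\<bar> ^ 2"
      \<comment> \<open>Divided differences are translation invariant, so the scheme for
        \<open>f\<close> becomes the same scheme for \<open>g\<close> in the error
        variables.\<close>
      have dd: "divdiff g (a - \<alpha>) (b - \<alpha>) = divdiff f a b" for a b
        by (simp add: divdiff_def g_def)
      have g: "g (a - \<alpha>) = f a" for a by (simp add: g_def)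
      have A: "eventually (\<lambda>x. x \<in> A \<and> x \<noteq> \<alpha>) F"
        unfolding F_def eventually_at_filter by (rule always_eventually) auto
      have eqs: "w x = x - \<kappa> * f x" "y x = x - f x / divdiff f x (w x)"
        "z x = y x - ((1 - g1 - g2) / divdiff f (y x) (w x) * G0 (f (y x) / f x)
             + g1 / divdiff f x (y x) * G1 (f (y x) / f (w x))
             + g2 / divdiff f x (w x) * G2 (f (y x) / f x) (f (y x) / f (w x))) * f (y x)" for x
        unfolding w_def y_def z_def by (simp_all only: w_step_def y_step_def z_step_def Let_def)
      have adm: "x \<noteq> w x" "y x \<noteq> w x" "x \<noteq> y x" "z x \<noteq> y x" "z x \<noteq> w x" "z x \<noteq> x"
        "f (w x) \<noteq> 0" "f (y x) \<noteq> 0" if "x \<in> A" for x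
        using that by (simp_all add: A_def admissible_def Let_def w_def y_def z_def)
      interpret scheme_step F "\<lambda>x. x - \<alpha>" g r r' r'' "deriv f \<alpha>" c2 c3 C \<delta> \<kappa> g1 g2 h
        a1 a2 a3 a4 a5 a6 a7 a8 G0 G1 G2 H "\<lambda>x. w x - \<alpha>" "\<lambda>x. y x - \<alpha>" "\<lambda>x. z x - \<alpha>"
      proof (unfold_locales)
        show "((\<lambda>x. x - \<alpha>) \<longlongrightarrow> 0) F" unfolding F_def by (intro tendsto_eq_intros) auto
        show "g u = deriv f \<alpha> * u + c2 * u ^ 2 + c3 * u ^ 3 + r u" for u
          using r(4) by (simp add: g_def)
        show "eventually (\<lambda>x. w x - \<alpha> = x - \<alpha> - \<kappa> * g (x - \<alpha>)) F"
          unfolding g by (simp add: eqs(1))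
        show "eventually (\<lambda>x. y x - \<alpha> = x - \<alpha> - g (x - \<alpha>) / divdiff g (x - \<alpha>) (w x - \<alpha>)) F"
          unfolding g dd by (simp add: eqs(2))
        show "eventually (\<lambda>x. z x - \<alpha> = y x - \<alpha> -
            ((1 - g1 - g2) / divdiff g (y x - \<alpha>) (w x - \<alpha>) * G0 (g (y x - \<alpha>) / g (x - \<alpha>))
             + g1 / divdiff g (x - \<alpha>) (y x - \<alpha>) * G1 (g (y x - \<alpha>) / g (w x - \<alpha>))
             + g2 / divdiff g (x - \<alpha>) (w x - \<alpha>)
               * G2 (g (y x - \<alpha>) / g (x - \<alpha>)) (g (y x - \<alpha>) / g (w x - \<alpha>))) * g (y x - \<alpha>)) F"
          unfolding g dd by (simp add: eqs(3))
      qed (use False r assms(5,6) G0 G1 G2 H adm A in \<open>auto simp: g elim!: eventually_mono\<close>)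
      obtain K where "(\<lambda>x. (z x - \<alpha>) - H (t3 x) (t4 x) (t5 x) * (g (z x - \<alpha>) / den x) - K * (x - \<alpha>) ^ (4 + p))
        \<in> O[F](\<lambda>x. (x - \<alpha>) ^ (4 + p + 1))"
        using step_error[OF p] by blast
      also have "(\<lambda>x. (z x - \<alpha>) - H (t3 x) (t4 x) (t5 x) * (g (z x - \<alpha>) / den x) - K * (x - \<alpha>) ^ (4 + p))
        = (\<lambda>x. (?\<Phi> x - \<alpha>) - K * (x - \<alpha>) ^ (4 + p))"
        unfolding t3_def t4_def t5_def den_def last_denom_def dd g
        by (simp add: fun_eq_iff scheme_def Let_def last_denom_def w_def y_def z_def)
      finally show ?thesis unfolding error_equation_def F_def A_def by blast
    qed
  qed
qed

text \<open>Identifies \<open>a8\<close> with the partial derivative of \<open>H\<close> in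
  \<open>t5\<close>. The filter \<open>nhds 0\<close> includes the point \<open>0\<close>, which
  gives \<open>\<phi> 0 = 1\<close>; the remainder divided by \<open>t\<close> then tends to
  \<open>0\<close>.\<close>

lemma deriv_of_linear_expansion:
  fixes \<phi> :: "real \<Rightarrow> real"
  assumes "(\<lambda>t. \<phi> t - (1 + a * t)) \<in> O[nhds 0](\<lambda>t. t ^ 2)"
  shows "deriv \<phi> 0 = a"
proof (rule DERIV_imp_deriv)
  obtain C where C: "C > 0" "eventually (\<lambda>t. \<bar>\<phi> t - (1 + a * t)\<bar> \<le> C * \<bar>t ^ 2\<bar>) (nhds 0)"
    using assms by (auto elim: landau_o.bigE)
  have \<phi>0: "\<phi> 0 = 1" using eventually_nhds_x_imp_x[OF C(2)] by simp
  have "eventually (\<lambda>t. norm ((\<phi> (0 + t) - \<phi> 0) / t - a) \<le> C * \<bar>t\<bar>) (at 0)"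
    using C(2) unfolding eventually_at_filter
  proof eventually_elim
    case (elim t)
    show ?case
    proof (intro impI)
      assume "t \<noteq> 0"
      then have "(\<phi> (0 + t) - \<phi> 0) / t - a = (\<phi> t - (1 + a * t)) / t"
        by (simp add: \<phi>0 field_simps)
      with elim \<open>t \<noteq> 0\<close> show "norm ((\<phi> (0 + t) - \<phi> 0) / t - a) \<le> C * \<bar>t\<bar>"
        by (simp add: abs_divide divide_le_eq power2_eq_square abs_mult mult.assoc)
    qed
  qed
  moreover have "((\<lambda>t. C * \<bar>t\<bar>) \<longlongrightarrow> 0) (at (0 :: real))" by (intro tendsto_mult_right_zero tendsto_rabs_zero tendsto_ident_at)
  ultimately have "((\<lambda>t. (\<phi> (0 + t) - \<phi> 0) / t - a) \<longlongrightarrow> 0) (at 0)"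
    by (rule Lim_null_comparison)
  then show "(\<phi> has_real_derivative a) (at 0)"
    by (simp add: DERIV_def LIM_zero_iff)
qed

theorem theorem5:
  fixes D :: "real set" and f :: "real \<Rightarrow> real" and \<alpha> :: real
    and \<kappa> g1 g2 h a1 a2 a3 a4 a5 a6 a7 a8 :: real
    and G0 G1 :: "real \<Rightarrow> real"
    and G2 :: "real \<Rightarrow> real \<Rightarrow> real"
    and H :: "real \<Rightarrow> real \<Rightarrow> real \<Rightarrow> real"
  assumes "open D" and "is_interval D"
    and "Ck_on 4 f D"
    and "\<alpha> \<in> D" and "f \<alpha> = 0" and "deriv f \<alpha> \<noteq> 0"
    and "\<kappa> \<noteq> 0"
    and "smooth_near G0 0" and "smooth_near G1 0"
    and "smooth_near (\<lambda>(t1, t2). G2 t1 t2) (0, 0)"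
    and "smooth_near (\<lambda>(t3, t4, t5). H t3 t4 t5) (0, 0, 0)"
    and "(\<lambda>t1. G0 t1 - (1 + t1 + a1 * t1\<^sup>2)) \<in> O[nhds 0](\<lambda>t1. t1 ^ 3)"
    and "(\<lambda>t2. G1 t2 - (1 + t2 + a2 * t2\<^sup>2)) \<in> O[nhds 0](\<lambda>t2. t2 ^ 3)"
    and "(\<lambda>(t1, t2). G2 t1 t2 - (1 + t1 + t2 + a3 * t1\<^sup>2 + a4 * t2\<^sup>2 + a5 * t1 * t2))
           \<in> O[nhds (0, 0)](\<lambda>t. norm t ^ 3)"
    and "(\<lambda>(t3, t4, t5). H t3 t4 t5 - (1 + a6 * t3 + a7 * t4 + a8 * t5))
           \<in> O[nhds (0, 0, 0)](\<lambda>t. norm t ^ 2)"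
  defines "\<Phi> \<equiv> scheme f \<kappa> g1 g2 h G0 G1 G2 H"
    and "A \<equiv> admissible D f \<kappa> g1 g2 h G0 G1 G2"
    and "conditions_i \<equiv>
           G0 0 = 1 \<and> G1 0 = 1 \<and> G2 0 0 = 1 \<and> H 0 0 0 = 1 \<and>
           deriv G0 0 = 1 \<and> deriv G1 0 = 1 \<and>
           deriv (\<lambda>t1. G2 t1 0) 0 = 1 \<and> deriv (\<lambda>t2. G2 0 t2) 0 = 1"
  shows "(conditions_i \<longrightarrow> convergence_order_at_least \<Phi> A \<alpha> 6) \<and>
         (conditions_i \<and> deriv (\<lambda>t5. H 0 0 t5) 0 = 0 \<longrightarrow> convergence_order_at_least \<Phi> A \<alpha> 7)"
proof -
  \<comment> \<open>Admissible points satisfy \<open>f x \<noteq> 0\<close>.\<close>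
  have "\<alpha> \<notin> A" using \<open>f \<alpha> = 0\<close> by (simp add: A_def admissible_def Let_def)
  then have order: "convergence_order_at_least \<Phi> A \<alpha> (4 + p)" if "p = 2 \<or> p = 3 \<and> a8 = 0" for p
    using scheme_error_equation[OF assms(1,3-7,12-15) that, of g1 g2 h]
      error_equation_imp_locally_convergent[of \<Phi> A \<alpha> "4 + p"]
    unfolding convergence_order_at_least_def \<Phi>_def A_def by auto
  \<comment> \<open>The expansion of \<open>H\<close> is restricted to the \<open>t5\<close> axis,
    where the norm is \<open>\<bar>t5\<bar>\<close>.\<close>
  have "((\<lambda>t5. (0, 0, t5)) \<longlongrightarrow> (0, 0, 0 :: real)) (nhds (0 :: real))"
    by (intro tendsto_Pair tendsto_const filterlim_ident)
  from landau_o.big.compose[OF assms(15) this]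
  have "(\<lambda>t5. H 0 0 t5 - (1 + a8 * t5)) \<in> O[nhds 0](\<lambda>t5. t5 ^ 2)"
    by (simp add: norm_Pair)
  then have "deriv (\<lambda>t5. H 0 0 t5) 0 = a8" by (rule deriv_of_linear_expansion)
  with order[of 2] order[of 3] show ?thesis by auto
qed

end
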